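(* Let $\mathcal{A}$ be a CDCSL algebra on a separable Hilbert space $\mathcal{H}$. If $\phi:\mathcal{A}\to\mathcal{A}$ is a linear mapping such that $\phi(A)\circ B+A\circ\phi(B)=0$ for all $A,B\in\mathcal{A}$ with $AB=BA=0$, then there exist a derivation $\delta:\mathcal{A}\to\mathcal{A}$ and a multiplier $\eta:\mathcal{A}\to\mathcal{A}$ such that $\phi=\delta+\eta$. If moreover $\phi(I)=0$, then $\phi$ is a derivation.
   Context: A CDCSL algebra is the algebra $\mathrm{Alg}\,\mathcal{L}$ of all bounded operators on $\mathcal{H}$ leaving invariant every projection in $\mathcal{L}$, where $\mathcal{L}$ is a completely distributive commutative subspace lattice (a strongly closed lattice of mutually commuting projections on $\mathcal{H}$ containing $0$ and $I$, which is completely distributive). $X\circ Y=XY+YX$. A linear $\delta$ is a derivation if $\delta(XY)=\delta(X)Y+X\delta(Y)$; a linear $\eta$ is a multiplier if $\eta(X)=\eta(I)X=X\eta(I)$ for all $X$. *)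

theory Defs
  imports Complex_Main "HOL-Library.Countable_Set"
begin

text \<open>A complex Hilbert space is modelled on a type 'h carrying an additive group
structure, together with a complex scalar multiplication and a complex inner
product (linear in the first argument).  Bounded operators are total functions
'h => 'h that are complex linear and bounded.\<close>

record 'h hspace =
  sc :: "complex \<Rightarrow> 'h \<Rightarrow> 'h"
  ip :: "'h \<Rightarrow> 'h \<Rightarrow> complex"

definition hnorm :: "('h::ab_group_add) hspace \<Rightarrow> 'h \<Rightarrow> real" where
  "hnorm H x = sqrt (Re (ip H x x))"

definition complex_hilbert_space :: "('h::ab_group_add) hspace \<Rightarrow> bool" where
  "complex_hilbert_space H \<longleftrightarrow>
     (\<forall>a x y. sc H a (x + y) = sc H a x + sc H a y) \<and>
     (\<forall>a b x. sc H (a + b) x = sc H a x + sc H b x) \<and>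
     (\<forall>a b x. sc H a (sc H b x) = sc H (a * b) x) \<and>
     (\<forall>x. sc H 1 x = x) \<and>
     (\<forall>x y z. ip H (x + y) z = ip H x z + ip H y z) \<and>
     (\<forall>a x y. ip H (sc H a x) y = a * ip H x y) \<and>
     (\<forall>x y. ip H y x = cnj (ip H x y)) \<and>
     (\<forall>x. Im (ip H x x) = 0 \<and> Re (ip H x x) \<ge> 0) \<and>
     (\<forall>x. ip H x x = 0 \<longrightarrow> x = 0) \<and>
     \<comment> \<open>completeness: every Cauchy sequence converges in the norm\<close>
     (\<forall>s :: nat \<Rightarrow> 'h.
        (\<forall>e>0. \<exists>N. \<forall>m\<ge>N. \<forall>n\<ge>N. hnorm H (s m - s n) < e) \<longrightarrow>
        (\<exists>l. \<forall>e>0. \<exists>N. \<forall>n\<ge>N. hnorm H (s n - l) < e))"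

definition separable :: "('h::ab_group_add) hspace \<Rightarrow> bool" where
  "separable H \<longleftrightarrow>
     (\<exists>D :: 'h set. countable D \<and> (\<forall>x. \<forall>e>0. \<exists>d\<in>D. hnorm H (x - d) < e))"

definition bounded_op :: "('h::ab_group_add) hspace \<Rightarrow> ('h \<Rightarrow> 'h) \<Rightarrow> bool" where
  "bounded_op H T \<longleftrightarrow>
     (\<forall>x y. T (x + y) = T x + T y) \<and>
     (\<forall>a x. T (sc H a x) = sc H a (T x)) \<and>
     (\<exists>K. \<forall>x. hnorm H (T x) \<le> K * hnorm H x)"

definition op_add :: "('h::ab_group_add \<Rightarrow> 'h) \<Rightarrow> ('h \<Rightarrow> 'h) \<Rightarrow> 'h \<Rightarrow> 'h" where
  "op_add S T = (\<lambda>x. S x + T x)"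

definition op_smult :: "('h::ab_group_add) hspace \<Rightarrow> complex \<Rightarrow> ('h \<Rightarrow> 'h) \<Rightarrow> 'h \<Rightarrow> 'h" where
  "op_smult H c T = (\<lambda>x. sc H c (T x))"

definition op_zero :: "'h::ab_group_add \<Rightarrow> 'h" where
  "op_zero = (\<lambda>x. 0)"

definition jordan :: "('h::ab_group_add \<Rightarrow> 'h) \<Rightarrow> ('h \<Rightarrow> 'h) \<Rightarrow> 'h \<Rightarrow> 'h" where
  "jordan X Y = op_add (X \<circ> Y) (Y \<circ> X)"

definition projection :: "('h::ab_group_add) hspace \<Rightarrow> ('h \<Rightarrow> 'h) \<Rightarrow> bool" where
  "projection H P \<longleftrightarrow> bounded_op H P \<and> P \<circ> P = P \<and>
     (\<forall>x y. ip H (P x) y = ip H x (P y))"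

text \<open>Order of projections: P \<le> Q iff range P \<subseteq> range Q iff QP = P.\<close>
definition proj_le :: "('h \<Rightarrow> 'h) \<Rightarrow> ('h \<Rightarrow> 'h) \<Rightarrow> bool" where
  "proj_le P Q \<longleftrightarrow> Q \<circ> P = P"

definition proj_sup :: "('h::ab_group_add) hspace \<Rightarrow> ('h \<Rightarrow> 'h) set \<Rightarrow> 'h \<Rightarrow> 'h" where
  "proj_sup H S = (THE P. projection H P \<and> (\<forall>Q\<in>S. proj_le Q P) \<and>
      (\<forall>R. projection H R \<and> (\<forall>Q\<in>S. proj_le Q R) \<longrightarrow> proj_le P R))"

definition proj_inf :: "('h::ab_group_add) hspace \<Rightarrow> ('h \<Rightarrow> 'h) set \<Rightarrow> 'h \<Rightarrow> 'h" where
  "proj_inf H S = (THE P. projection H P \<and> (\<forall>Q\<in>S. proj_le P Q) \<and>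
      (\<forall>R. projection H R \<and> (\<forall>Q\<in>S. proj_le R Q) \<longrightarrow> proj_le R P))"

definition strongly_closed :: "('h::ab_group_add) hspace \<Rightarrow> ('h \<Rightarrow> 'h) set \<Rightarrow> bool" where
  "strongly_closed H L \<longleftrightarrow>
     (\<forall>T. bounded_op H T \<and>
          (\<forall>F e. finite F \<and> e > 0 \<longrightarrow> (\<exists>P\<in>L. \<forall>x\<in>F. hnorm H (T x - P x) < e))
        \<longrightarrow> T \<in> L)"

text \<open>Complete distributivity: for every family of subsets of L,
  meet over the family of the joins equals the join over all choice functions
  of the meets.  (Indexing the family by subsets of L is equivalent to indexing
  by an arbitrary index set.)\<close>
definition completely_distributive :: "('h::ab_group_add) hspace \<Rightarrow> ('h \<Rightarrow> 'h) set \<Rightarrow> bool" where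
  "completely_distributive H L \<longleftrightarrow>
     (\<forall>\<S>. \<S> \<subseteq> Pow L \<longrightarrow>
        proj_inf H ((\<lambda>S. proj_sup H S) ` \<S>) =
        proj_sup H ((\<lambda>f. proj_inf H (f ` \<S>)) ` {f. \<forall>S\<in>\<S>. f S \<in> S}))"

definition CDCSL :: "('h::ab_group_add) hspace \<Rightarrow> ('h \<Rightarrow> 'h) set \<Rightarrow> bool" where
  "CDCSL H L \<longleftrightarrow>
     (\<forall>P\<in>L. projection H P) \<and>
     op_zero \<in> L \<and> id \<in> L \<and>
     (\<forall>P\<in>L. \<forall>Q\<in>L. P \<circ> Q = Q \<circ> P) \<and>
     (\<forall>P\<in>L. \<forall>Q\<in>L. proj_sup H {P, Q} \<in> L \<and> proj_inf H {P, Q} \<in> L) \<and>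
     strongly_closed H L \<and>
     completely_distributive H L"

definition Alg :: "('h::ab_group_add) hspace \<Rightarrow> ('h \<Rightarrow> 'h) set \<Rightarrow> ('h \<Rightarrow> 'h) set" where
  "Alg H L = {T. bounded_op H T \<and> (\<forall>P\<in>L. P \<circ> T \<circ> P = T \<circ> P)}"

definition linear_on :: "('h::ab_group_add) hspace \<Rightarrow> ('h \<Rightarrow> 'h) set
     \<Rightarrow> (('h \<Rightarrow> 'h) \<Rightarrow> ('h \<Rightarrow> 'h)) \<Rightarrow> bool" where
  "linear_on H A f \<longleftrightarrow> (\<forall>X\<in>A. f X \<in> A) \<and>
     (\<forall>X\<in>A. \<forall>Y\<in>A. f (op_add X Y) = op_add (f X) (f Y)) \<and>
     (\<forall>c. \<forall>X\<in>A. f (op_smult H c X) = op_smult H c (f X))"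

definition derivation_on :: "('h::ab_group_add) hspace \<Rightarrow> ('h \<Rightarrow> 'h) set
     \<Rightarrow> (('h \<Rightarrow> 'h) \<Rightarrow> ('h \<Rightarrow> 'h)) \<Rightarrow> bool" where
  "derivation_on H A d \<longleftrightarrow> linear_on H A d \<and>
     (\<forall>X\<in>A. \<forall>Y\<in>A. d (X \<circ> Y) = op_add (d X \<circ> Y) (X \<circ> d Y))"

definition multiplier_on :: "('h::ab_group_add) hspace \<Rightarrow> ('h \<Rightarrow> 'h) set
     \<Rightarrow> (('h \<Rightarrow> 'h) \<Rightarrow> ('h \<Rightarrow> 'h)) \<Rightarrow> bool" where
  "multiplier_on H A e \<longleftrightarrow> linear_on H A e \<and>
     (\<forall>X\<in>A. e X = e id \<circ> X \<and> e X = X \<circ> e id)"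

end

theory Submission
  imports Defs
begin

text \<open>
Orthogonality of an idempotent e and 1 - e shows that \<phi>(1) commutes with all idempotents.
Every rank one operator of the algebra is a combination of idempotents of the algebra, and complete
distributivity makes the rank one operators separating, so \<phi>(1) is central. Subtracting the
multiplier \<phi>(1) X one may assume \<phi>(1) = 0.

For an idempotent e the pairs of orthogonal elements e s e and (1 - e) t (1 - e), together with
their conjugates under e + x for x in an off-diagonal Peirce corner, give \<phi>(e t) = \<phi>(e) t + e \<phi>(t)
up to the two components mapping one off-diagonal corner into the other. These vanish if one of the
corners is zero, and also if e has rank one, because an off-diagonal corner element is then fixed by
multiplication with an operator that kills its image. Hence the Leibniz rule holds for a rank one left
factor, and r (\<phi>(s t) - \<phi>(s) t - s \<phi>(t)) = 0 for all rank one r gives it in general.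
\<close>

section \<open>Orthogonality preservers on rings\<close>

text \<open>No continuity of \<open>\<phi>\<close> is assumed, so identities known on rank one
  operators cannot be carried to the whole algebra by density. The passage is purely algebraic: the
  rank one operators in question are stable under multiplication from the right, and comparing an
  identity at \<open>r\<close> and at \<open>r * s\<close> shows that \<open>r\<close> annihilates
  the defect; separation does the rest.

  The obstacle is that the hypothesis involves Jordan products only and therefore reads the same in
  the opposite ring: antiderivations satisfy it as well as derivations. An antiderivation part would
  show up as a map from one off-diagonal Peirce corner into the other, and ring identities alone
  cannot exclude it. For X in such a corner they give only X \<phi>(X) e = 0 or e \<phi>(X) X = 0,
  which controls the unwanted component along X alone. A factor w with X w = X or w X = X that
  factors through this controlled direction makes the component vanish on the whole corner. Building
  w inside the algebra is where the lattice enters.\<close>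

text \<open>The sort ring, monoid_mult stands for unital rings in which 0 = 1 is allowed: ring_1 would
  exclude the endomorphisms of a trivial group.\<close>

locale orthogonal_map =
  fixes A :: "'a::{ring,monoid_mult} set" and \<phi> :: "'a \<Rightarrow> 'a"
  assumes A_one [simp]: "1 \<in> A"
    and A_add [simp]: "x \<in> A \<Longrightarrow> y \<in> A \<Longrightarrow> x + y \<in> A"
    and A_minus [simp]: "x \<in> A \<Longrightarrow> - x \<in> A"
    and A_mult [simp]: "x \<in> A \<Longrightarrow> y \<in> A \<Longrightarrow> x * y \<in> A"
    and map_closed [simp]: "x \<in> A \<Longrightarrow> \<phi> x \<in> A"
    and map_add: "x \<in> A \<Longrightarrow> y \<in> A \<Longrightarrow> \<phi> (x + y) = \<phi> x + \<phi> y"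
    and torsion: "x + x = 0 \<Longrightarrow> (x::'a) = 0"
    and orthogonal: "x \<in> A \<Longrightarrow> y \<in> A \<Longrightarrow> x * y = 0 \<Longrightarrow> y * x = 0 \<Longrightarrow>
      \<phi> x * y + y * \<phi> x + x * \<phi> y + \<phi> y * x = 0"
begin

lemma A_diff [simp]: "x \<in> A \<Longrightarrow> y \<in> A \<Longrightarrow> x - y \<in> A"
  using A_add[of x "- y"] by simp

lemma A_zero [simp]: "0 \<in> A"
  using A_diff[of 1 1] by simp

lemma map_zero [simp]: "\<phi> 0 = 0"
  using map_add[of 0 0] by simp

lemma map_minus: "x \<in> A \<Longrightarrow> \<phi> (- x) = - \<phi> x"
  using map_add[of x "- x"] by (simp add: eq_neg_iff_add_eq_0 add.commute)

lemma map_diff: "x \<in> A \<Longrightarrow> y \<in> A \<Longrightarrow> \<phi> (x - y) = \<phi> x - \<phi> y"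
  using map_add[of x "- y"] by (simp add: map_minus)

lemma map_one_idempotent_equation:
  assumes "e \<in> A" "e * e = e"
  shows "\<phi> e + \<phi> e + e * \<phi> 1 + \<phi> 1 * e = (\<phi> e * e + e * \<phi> e) + (\<phi> e * e + e * \<phi> e)"
proof -
  have "\<phi> e * (1 - e) + (1 - e) * \<phi> e + e * \<phi> (1 - e) + \<phi> (1 - e) * e = 0"
    using assms by (intro orthogonal) (auto simp: algebra_simps)
  then show ?thesis
    using assms by (simp add: map_diff algebra_simps)
qed

text \<open>In both off-diagonal corners \<open>\<phi> e * e + e * \<phi> e\<close> agrees with
  \<open>\<phi> e\<close>, so compressing the preceding equation to such a corner leaves only that
  corner of \<open>\<phi> 1\<close>, which must vanish.\<close>

lemma map_one_commute_idempotent: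
  assumes e: "e \<in> A" "e * e = e"
  shows "\<phi> 1 * e = e * \<phi> 1"
proof -
  note eq = map_one_idempotent_equation[OF e]
  have ee: "e * (e * x) = e * x" for x using e by (simp flip: mult.assoc)
  have "e * (\<phi> e + \<phi> e + e * \<phi> 1 + \<phi> 1 * e) * (1 - e)
      = e * ((\<phi> e * e + e * \<phi> e) + (\<phi> e * e + e * \<phi> e)) * (1 - e)"
    by (simp only: eq)
  then have 1: "e * \<phi> 1 = e * \<phi> 1 * e"
    using e by (simp add: algebra_simps ee)
  have "(1 - e) * (\<phi> e + \<phi> e + e * \<phi> 1 + \<phi> 1 * e) * e
      = (1 - e) * ((\<phi> e * e + e * \<phi> e) + (\<phi> e * e + e * \<phi> e)) * e"
    by (simp only: eq)
  then have 2: "\<phi> 1 * e = e * \<phi> 1 * e"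
    using e by (simp add: algebra_simps ee)
  show ?thesis using 1 2 by simp
qed

text \<open>Since \<open>r * t\<close> stays in \<open>J\<close>, \<open>\<phi> 1\<close> can be
  moved past \<open>r\<close> and back past \<open>r * t\<close>; hence every \<open>r\<close> in
  \<open>J\<close> kills the commutator of \<open>\<phi> 1\<close> and \<open>t\<close>.\<close>

lemma map_one_central_if_separating:
  assumes ideal: "\<And>r t. r \<in> J \<Longrightarrow> t \<in> A \<Longrightarrow> r * t \<in> J"
    and commute: "\<And>r. r \<in> J \<Longrightarrow> \<phi> 1 * r = r * \<phi> 1"
    and separating: "\<And>w. w \<in> A \<Longrightarrow> (\<And>r. r \<in> J \<Longrightarrow> r * w = 0) \<Longrightarrow> w = 0"
    and t: "t \<in> A"
  shows "\<phi> 1 * t = t * \<phi> 1"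
proof -
  have "r * (\<phi> 1 * t - t * \<phi> 1) = 0" if "r \<in> J" for r
  proof -
    have "r * (\<phi> 1 * t) = (\<phi> 1 * r) * t" by (simp only: commute[OF that] mult.assoc)
    also have "\<dots> = r * (t * \<phi> 1)" using commute[OF ideal[OF that t]] by (simp only: mult.assoc)
    finally show ?thesis by (simp add: right_diff_distrib)
  qed
  then have "\<phi> 1 * t - t * \<phi> 1 = 0" by (rule separating[rotated]) (use t in auto)
  then show ?thesis by simp
qed

end

locale normalized_orthogonal_map = orthogonal_map A \<phi>
  for A :: "'a::{ring,monoid_mult} set" and \<phi> +
  assumes map_one [simp]: "\<phi> 1 = 0"
begin

text \<open>Expand \<open>\<phi> (r * s * t)\<close> with left factor \<open>r * s\<close> and again
  with left factor \<open>r\<close>; the difference is \<open>r\<close> times the Leibniz defect of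
  \<open>s\<close> and \<open>t\<close>.\<close>

lemma leibniz_if_separating:
  assumes J: "J \<subseteq> A" and ideal: "\<And>r t. r \<in> J \<Longrightarrow> t \<in> A \<Longrightarrow> r * t \<in> J"
    and leibniz: "\<And>r t. r \<in> J \<Longrightarrow> t \<in> A \<Longrightarrow> \<phi> (r * t) = \<phi> r * t + r * \<phi> t"
    and separating: "\<And>w. w \<in> A \<Longrightarrow> (\<And>r. r \<in> J \<Longrightarrow> r * w = 0) \<Longrightarrow> w = 0"
    and st: "s \<in> A" "t \<in> A"
  shows "\<phi> (s * t) = \<phi> s * t + s * \<phi> t"
proof -
  have "r * (\<phi> (s * t) - (\<phi> s * t + s * \<phi> t)) = 0" if r: "r \<in> J" for r
    using leibniz[OF ideal[OF r st(1)] st(2)] leibniz[OF r st(1)] leibniz[OF r, of "s * t"] st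
    by (simp add: algebra_simps)
  then have "\<phi> (s * t) - (\<phi> s * t + s * \<phi> t) = 0" by (rule separating[rotated]) (use st in auto)
  then show ?thesis by simp
qed

lemma double_cancel: "x + x = y + y \<Longrightarrow> x = (y::'a)"
  using torsion[of "x - y"] by (simp add: algebra_simps)

text \<open>Meant for \<open>a\<close> and \<open>b\<close> the parts of odd and even degree in some
  \<open>x\<close>: replacing \<open>x\<close> by \<open>- x\<close> flips the sign of
  \<open>a\<close> only.\<close>

lemma even_odd_zero:
  assumes "a + b = (0::'a)" "b - a = 0" shows "a = 0" "b = 0"
proof -
  have b: "b = a" using assms(2) by simp
  have "a + a = 0" using assms(1) unfolding b .
  then show "a = 0" by (rule torsion)
  then show "b = 0" unfolding b .
qed

lemma map_idempotent: "e \<in> A \<Longrightarrow> e * e = e \<Longrightarrow> \<phi> e = \<phi> e * e + e * \<phi> e"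
  by (rule double_cancel) (use map_one_idempotent_equation[of e] in simp)

end

section \<open>Peirce decomposition at an idempotent\<close>

locale map_at_idempotent = normalized_orthogonal_map A \<phi>
  for A :: "'a::{ring,monoid_mult} set" and \<phi> +
  fixes e f :: 'a
  assumes e_in [simp]: "e \<in> A" and e_idem [simp]: "e * e = e" and f_def: "f = 1 - e"
begin

lemma f_in [simp]: "f \<in> A" by (simp add: f_def)
lemma ef_simps [simp]: "e * f = 0" "f * e = 0" "f * f = f"
  "e * (e * x) = e * x" "e * (f * x) = 0" "f * (e * x) = 0" "f * (f * x) = f * x"
  by (simp_all add: f_def algebra_simps flip: mult.assoc)
lemma map_f: "\<phi> f = - \<phi> e" by (simp add: f_def map_diff)

text \<open>Compressing \<open>\<phi> e = \<phi> e * e + e * \<phi> e\<close> to a diagonal corner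
  equates that corner of \<open>\<phi> e\<close> with its double (for \<open>e\<close>) or with zero
  (for \<open>f\<close>). The versions with a trailing \<open>x\<close> match inside right-nested
  products.\<close>

lemma corner_map_e [simp]: "e * (\<phi> e * e) = 0" "f * (\<phi> e * f) = 0"
  "e * (\<phi> e * (e * x)) = 0" "f * (\<phi> e * (f * x)) = 0"
proof -
  have "e * \<phi> e * e = e * (\<phi> e * e + e * \<phi> e) * e"
    using map_idempotent[of e] by simp
  then show 1: "e * (\<phi> e * e) = 0" by (simp add: algebra_simps)
  have "f * \<phi> e * f = f * (\<phi> e * e + e * \<phi> e) * f"
    using map_idempotent[of e] by simp
  then show 2: "f * (\<phi> e * f) = 0" by (simp add: algebra_simps)
  show "e * (\<phi> e * (e * x)) = 0" "f * (\<phi> e * (f * x)) = 0"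
    using arg_cong[OF 1, of "\<lambda>y. y * x"] arg_cong[OF 2, of "\<lambda>y. y * x"]
    by (simp_all only: mult.assoc mult_zero_left)
qed

lemma map_ee:
  assumes "t \<in> A"
  defines "u \<equiv> e * t * e"
  shows "\<phi> u + \<phi> u = \<phi> u * e + e * \<phi> u + u * \<phi> e + \<phi> e * u"
proof -
  have "\<phi> u * f + f * \<phi> u + u * \<phi> f + \<phi> f * u = 0"
    using assms by (intro orthogonal) (auto simp: mult.assoc)
  then show ?thesis by (simp add: map_f) (simp add: f_def algebra_simps)
qed

lemma map_ff:
  assumes "t \<in> A"
  defines "v \<equiv> f * t * f"
  shows "\<phi> v * e + e * \<phi> v + v * \<phi> e + \<phi> e * v = 0"
  using orthogonal[of v e] assms by (auto simp: mult.assoc)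

text \<open>Both \<open>e + x\<close> and \<open>e - x\<close> are idempotents. In the resulting
  identities the terms linear in \<open>x\<close> give the first claim and the quadratic ones the
  second. The hypotheses hold in both off-diagonal corners.\<close>

lemma map_square_zero:
  assumes x: "x \<in> A" "x * x = 0" "e * x + x * e = x"
  shows "\<phi> x = \<phi> x * e + e * \<phi> x + x * \<phi> e + \<phi> e * x" "\<phi> x * x + x * \<phi> x = 0"
proof -
  have xe: "e * x = x - x * e" using x(3) by (simp add: algebra_simps)
  have *: "\<phi> (e + x) = \<phi> (e + x) * (e + x) + (e + x) * \<phi> (e + x)"
    using x xe by (intro map_idempotent) (auto simp: algebra_simps)
  have **: "\<phi> (e - x) = \<phi> (e - x) * (e - x) + (e - x) * \<phi> (e - x)"
    using x xe by (intro map_idempotent) (auto simp: algebra_simps)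
  note m = map_idempotent[OF e_in e_idem]
  let ?l = "\<phi> x * e + e * \<phi> x + x * \<phi> e + \<phi> e * x - \<phi> x" and ?q = "\<phi> x * x + x * \<phi> x"
  have cancel: "k + (l + y + q) = k + y \<Longrightarrow> l + q = 0" "k + (- l - y + q) = k - y \<Longrightarrow> q - l = 0"
    for k l y q :: 'a by (simp_all add: algebra_simps)
  have "(\<phi> e * e + e * \<phi> e) + (?l + \<phi> x + ?q) = \<phi> e + \<phi> x"
    using *[symmetric] x(1) by (simp add: map_add algebra_simps)
  then have 1: "?l + ?q = 0"
    unfolding m[symmetric] by (rule cancel)
  have "(\<phi> e * e + e * \<phi> e) + (- ?l - \<phi> x + ?q) = \<phi> e - \<phi> x"
    using **[symmetric] x(1) by (simp add: map_diff algebra_simps)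
  then have 2: "?q - ?l = 0"
    unfolding m[symmetric] by (rule cancel)
  show "\<phi> x = \<phi> x * e + e * \<phi> x + x * \<phi> e + \<phi> e * x" "?q = 0"
    using even_odd_zero[OF 1 2] by simp_all
qed

lemma map_ef:
  assumes "t \<in> A"
  defines "x \<equiv> e * t * f"
  shows "\<phi> x = \<phi> x * e + e * \<phi> x + x * \<phi> e + \<phi> e * x" "\<phi> x * x + x * \<phi> x = 0"
proof -
  have "x \<in> A" "x * x = 0" "e * x + x * e = x"
    using assms(1) by (simp_all add: x_def mult.assoc)
  then show "\<phi> x = \<phi> x * e + e * \<phi> x + x * \<phi> e + \<phi> e * x" "\<phi> x * x + x * \<phi> x = 0"
    by (fact map_square_zero)+
qed

lemma map_fe:
  assumes "t \<in> A"
  defines "x \<equiv> f * t * e"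
  shows "\<phi> x = \<phi> x * e + e * \<phi> x + x * \<phi> e + \<phi> e * x" "\<phi> x * x + x * \<phi> x = 0"
proof -
  have "x \<in> A" "x * x = 0" "e * x + x * e = x"
    using assms(1) by (simp_all add: x_def mult.assoc)
  then show "\<phi> x = \<phi> x * e + e * \<phi> x + x * \<phi> e + \<phi> e * x" "\<phi> x * x + x * \<phi> x = 0"
    by (fact map_square_zero)+
qed

lemma decompose: "t = e * t * e + e * t * f + f * t * e + f * t * f"
  by (simp add: f_def algebra_simps)

lemma absorb:
  "y = e * z \<Longrightarrow> e * y = y" "y = e * z \<Longrightarrow> f * y = 0" "y = f * z \<Longrightarrow> f * y = y" "y = f * z \<Longrightarrow> e * y = 0"
  "y = z * e \<Longrightarrow> y * e = y" "y = z * e \<Longrightarrow> y * f = 0" "y = z * f \<Longrightarrow> y * f = y" "y = z * f \<Longrightarrow> y * e = 0"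
  by (simp_all add: mult.assoc)

text \<open>Orthogonality of the idempotent e + x and w - x w, which lies in the corner of 1 - e - x.\<close>
lemma transfer_ef:
  assumes x: "x \<in> A" "x = e * x * f" and w: "w \<in> A" "w = f * w * f"
  shows "f * \<phi> (x * w) * e = w * \<phi> x * e"
proof -
  have ew [simp]: "e * w = 0" "w * e = 0" "f * w = w" "w * f = w"
    by (rule absorb, rule w(2)[unfolded mult.assoc] w(2))+
  have ex [simp]: "e * x = x" "x * e = 0" "f * x = 0" "x * f = x"
    by (rule absorb, rule x(2)[unfolded mult.assoc] x(2))+
  let ?l = "\<phi> w * x + x * \<phi> w - \<phi> (x * w) * e - e * \<phi> (x * w) + w * \<phi> x + \<phi> x * w
      - x * w * \<phi> e - \<phi> e * (x * w)"
    and ?q = "- (\<phi> (x * w) * x) - x * \<phi> (x * w) - x * w * \<phi> x - \<phi> x * (x * w)"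
  have xx [simp]: "x * x = 0" "w * x = 0"
    using mult.assoc[of x e x] mult.assoc[of w f x] by simp_all
  have ass [simp]: "x * (x * z) = 0" "w * (x * z) = 0" "e * (x * z) = x * z" "f * (x * z) = 0"
     "x * (e * z) = 0" "w * (e * z) = 0" "f * (w * z) = w * z" for z
    by (simp_all flip: mult.assoc)
  \<comment> \<open>The part of degree 0 in \<open>x\<close>; \<open>?l\<close> and
    \<open>?q\<close> are the parts of degree 1 and 2.\<close>
  have d0: "\<phi> w * e + e * \<phi> w + w * \<phi> e + \<phi> e * w = 0"
    using map_ff[OF w(1)] by (simp flip: w(2))
  have "\<phi> (w - x * w) * (e + x) + (e + x) * \<phi> (w - x * w) + (w - x * w) * \<phi> (e + x)
      + \<phi> (e + x) * (w - x * w) = 0"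
    using x(1) w(1) by (intro orthogonal) (simp_all add: algebra_simps)
  then have "(\<phi> w * e + e * \<phi> w + w * \<phi> e + \<phi> e * w) + (?q + ?l) = 0"
    using x(1) w(1) by (simp add: map_add map_diff algebra_simps)
  then have 1: "?q + ?l = 0" unfolding d0 by simp
  \<comment> \<open>The same orthogonal pair with \<open>- x\<close> in place of \<open>x\<close>,
    in order to isolate \<open>?l\<close>.\<close>
  have "\<phi> (w + x * w) * (e - x) + (e - x) * \<phi> (w + x * w) + (w + x * w) * \<phi> (e - x)
      + \<phi> (e - x) * (w + x * w) = 0"
    using x(1) w(1) by (intro orthogonal) (simp_all add: algebra_simps)
  then have "(\<phi> w * e + e * \<phi> w + w * \<phi> e + \<phi> e * w) + (?q - ?l) = 0"
    using x(1) w(1) by (simp add: map_add map_diff algebra_simps)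
  then have 2: "?q - ?l = 0" unfolding d0 by simp
  have "?l = 0" using even_odd_zero[of ?l ?q] 1 2 by (simp add: algebra_simps)
  then have "f * ?l * e = 0" by simp
  then show ?thesis by (simp add: algebra_simps)
qed

text \<open>The mirror image of \<open>transfer_ef\<close>: for \<open>x\<close> in the opposite
  corner the element orthogonal to \<open>e + x\<close> is \<open>w - w * x\<close>.\<close>

lemma transfer_fe:
  assumes x: "x \<in> A" "x = f * x * e" and w: "w \<in> A" "w = f * w * f"
  shows "e * \<phi> (w * x) * f = e * \<phi> x * w"
proof -
  have ew [simp]: "e * w = 0" "w * e = 0" "f * w = w" "w * f = w"
    by (rule absorb, rule w(2)[unfolded mult.assoc] w(2))+
  have ex [simp]: "f * x = x" "x * f = 0" "e * x = 0" "x * e = x"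
    by (rule absorb, rule x(2)[unfolded mult.assoc] x(2))+
  let ?l = "\<phi> w * x + x * \<phi> w - \<phi> (w * x) * e - e * \<phi> (w * x) + w * \<phi> x + \<phi> x * w
      - w * x * \<phi> e - \<phi> e * (w * x)"
    and ?q = "- (\<phi> (w * x) * x) - x * \<phi> (w * x) - w * x * \<phi> x - \<phi> x * (w * x)"
  have xx [simp]: "x * x = 0" "x * w = 0"
    using mult.assoc[of x f x] mult.assoc[of x f w] by simp_all
  have ass [simp]: "x * (x * z) = 0" "x * (w * z) = 0" "f * (x * z) = x * z" "e * (x * z) = 0"
     "e * (w * z) = 0" "x * (f * z) = 0" "w * (f * z) = w * z" for z
    by (simp_all flip: mult.assoc)
  have d0: "\<phi> w * e + e * \<phi> w + w * \<phi> e + \<phi> e * w = 0"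
    using map_ff[OF w(1)] by (simp flip: w(2))
  have "\<phi> (w - w * x) * (e + x) + (e + x) * \<phi> (w - w * x) + (w - w * x) * \<phi> (e + x)
      + \<phi> (e + x) * (w - w * x) = 0"
    using x(1) w(1) by (intro orthogonal) (simp_all add: algebra_simps)
  then have "(\<phi> w * e + e * \<phi> w + w * \<phi> e + \<phi> e * w) + (?q + ?l) = 0"
    using x(1) w(1) by (simp add: map_add map_diff algebra_simps)
  then have 1: "?q + ?l = 0" unfolding d0 by simp
  have "\<phi> (w + w * x) * (e - x) + (e - x) * \<phi> (w + w * x) + (w + w * x) * \<phi> (e - x)
      + \<phi> (e - x) * (w + w * x) = 0"
    using x(1) w(1) by (intro orthogonal) (simp_all add: algebra_simps)
  then have "(\<phi> w * e + e * \<phi> w + w * \<phi> e + \<phi> e * w) + (?q - ?l) = 0"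
    using x(1) w(1) by (simp add: map_add map_diff algebra_simps)
  then have 2: "?q - ?l = 0" unfolding d0 by simp
  have "?l = 0" using even_odd_zero[of ?l ?q] 1 2 by (simp add: algebra_simps)
  then have "e * ?l * f = 0" by simp
  then show ?thesis by (simp add: algebra_simps)
qed

text \<open>Multiplying the quadratic identity by \<open>e\<close> on the right removes the summand
  ending in \<open>e * t * f\<close>. What remains says that the unwanted component takes values in
  the kernel of \<open>e * t * f\<close>.\<close>

lemma annihilate_ef:
  assumes "t \<in> A" shows "e * t * f * \<phi> (e * t * f) * e = 0"
proof -
  have "(\<phi> (e * t * f) * (e * t * f) + (e * t * f) * \<phi> (e * t * f)) * e = 0"
    using map_ef(2)[OF assms] by simp
  then show ?thesis by (simp add: algebra_simps)
qed

lemma annihilate_fe: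
  assumes "t \<in> A" shows "e * \<phi> (f * t * e) * (f * t * e) = 0"
proof -
  have "e * (\<phi> (f * t * e) * (f * t * e) + (f * t * e) * \<phi> (f * t * e)) = 0"
    using map_fe(2)[OF assms] by simp
  then show ?thesis by (simp add: algebra_simps)
qed

text \<open>The hypotheses ef and fe exclude an antiderivation part, as in the Jordan derivations of
  general rings.\<close>
lemma leibniz_idempotent:
  assumes t: "t \<in> A"
    and ef: "f * \<phi> (e * t * f) * e = 0" and fe: "e * \<phi> (f * t * e) * f = 0"
  shows "\<phi> (e * t) = \<phi> e * t + e * \<phi> t"
proof -
  \<comment> \<open>As \<open>e * a = a\<close>, \<open>e * b = b\<close> and
    \<open>e * c = e * d = 0\<close>, the four claims below are the Leibniz rule at each Peirce
    component. The hypotheses \<open>ef\<close> and \<open>fe\<close> enter at \<open>b\<close> and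
    \<open>c\<close> only.\<close>
  define a b c d where abcd: "a = e * t * e" "b = e * t * f" "c = f * t * e" "d = f * t * f"
  have in_A: "a \<in> A" "b \<in> A" "c \<in> A" "d \<in> A" using t abcd by auto
  have td: "t = a + b + c + d" using decompose[of t] abcd by simp
  have et: "e * t = a + b" by (simp add: abcd f_def algebra_simps)
  have 1: "\<phi> a = \<phi> e * a + e * \<phi> a"
  proof -
    have eq: "\<phi> a + \<phi> a = \<phi> a * e + e * \<phi> a + a * \<phi> e + \<phi> e * a"
      using map_ee[OF t] by (simp add: abcd)
    have a: "a = e * (t * e)" "a = (e * t) * e" by (simp_all add: abcd mult.assoc)
    note [simp] = absorb(1,2)[OF a(1)] absorb(5,6)[OF a(2)]
    have [simp]: "f * (a * z) = 0" "e * (a * z) = a * z" for z by (simp_all flip: mult.assoc)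
    have "f * (\<phi> a + \<phi> a) * f = f * (\<phi> a * e + e * \<phi> a + a * \<phi> e + \<phi> e * a) * f"
      by (simp only: eq)
    then have "f * \<phi> a * f + f * \<phi> a * f = 0" by (simp add: algebra_simps)
    then have ff: "f * \<phi> a * f = 0" by (rule torsion)
    have "f * (\<phi> a + \<phi> a) * e = f * (\<phi> a * e + e * \<phi> a + a * \<phi> e + \<phi> e * a) * e"
      by (simp only: eq)
    then have fe: "f * \<phi> a * e = f * \<phi> e * a" by (simp add: algebra_simps)
    have "e * \<phi> e * a = 0" using a(1) by (simp add: mult.assoc)
    then have e1: "\<phi> e * a = f * \<phi> e * a" by (simp add: f_def algebra_simps)
    have "\<phi> a = e * \<phi> a + f * \<phi> a * e + f * \<phi> a * f"
      by (simp add: f_def algebra_simps)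
    also have "\<dots> = e * \<phi> a + \<phi> e * a" by (simp only: ff fe e1 add_0_right)
    finally show ?thesis by (simp only: add.commute)
  qed
  have 2: "\<phi> b = \<phi> e * b + e * \<phi> b"
  proof -
    have eq: "\<phi> b = \<phi> b * e + e * \<phi> b + b * \<phi> e + \<phi> e * b"
      using map_ef(1)[OF t] by (simp only: abcd)
    have b: "b = e * (t * f)" "b = (e * t) * f" by (simp_all add: abcd mult.assoc)
    note [simp] = absorb(1,2)[OF b(1)] absorb(7,8)[OF b(2)]
    have [simp]: "f * (b * z) = 0" for z by (simp flip: mult.assoc)
    have "f * \<phi> b * f = f * (\<phi> b * e + e * \<phi> b + b * \<phi> e + \<phi> e * b) * f"
      by (simp only: eq[symmetric])
    then have ff: "f * \<phi> b * f = f * \<phi> e * b" by (simp add: algebra_simps)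
    have "e * \<phi> e * b = 0" using b(1) by (simp add: mult.assoc)
    then have e1: "\<phi> e * b = f * \<phi> e * b" by (simp add: f_def algebra_simps)
    have "\<phi> b = e * \<phi> b + f * \<phi> b * e + f * \<phi> b * f"
      by (simp add: f_def algebra_simps)
    also have "\<dots> = e * \<phi> b + \<phi> e * b"
      using ef[folded abcd] by (simp only: ff e1 add_0_right)
    finally show ?thesis by (simp only: add.commute)
  qed
  have 3: "\<phi> e * c + e * \<phi> c = 0"
  proof -
    have eq: "\<phi> c = \<phi> c * e + e * \<phi> c + c * \<phi> e + \<phi> e * c"
      using map_fe(1)[OF t] by (simp only: abcd)
    have c: "c = f * (t * e)" "c = (f * t) * e" by (simp_all add: abcd mult.assoc)
    note [simp] = absorb(3,4)[OF c(1)] absorb(5,6)[OF c(2)]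
    have [simp]: "e * (c * z) = 0" for z by (simp flip: mult.assoc)
    have "e * \<phi> c * e = e * (\<phi> c * e + e * \<phi> c + c * \<phi> e + \<phi> e * c) * e"
      by (simp only: eq[symmetric])
    then have ee: "e * \<phi> c * e + e * \<phi> e * c = 0" by (simp add: algebra_simps)
    have "f * \<phi> e * c = 0" using c(1) by (simp add: mult.assoc)
    then have "\<phi> e * c = e * \<phi> e * c" by (simp add: f_def algebra_simps)
    moreover have "e * \<phi> c = e * \<phi> c * e + e * \<phi> c * f"
      by (simp add: f_def algebra_simps)
    ultimately show ?thesis using fe ee by (simp add: abcd add.commute)
  qed
  have 4: "\<phi> e * d + e * \<phi> d = 0"
  proof -
    have eq: "\<phi> d * e + e * \<phi> d + d * \<phi> e + \<phi> e * d = 0"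
      using map_ff[OF t] by (simp add: abcd)
    have d: "d = f * (t * f)" "d = (f * t) * f" by (simp_all add: abcd mult.assoc)
    note [simp] = absorb(3,4)[OF d(1)] absorb(7,8)[OF d(2)]
    have [simp]: "e * (d * z) = 0" for z by (simp flip: mult.assoc)
    have "e * (\<phi> d * e + e * \<phi> d + d * \<phi> e + \<phi> e * d) * e = 0" by (simp only: eq) simp
    then have "e * \<phi> d * e + e * \<phi> d * e = 0" by (simp add: algebra_simps)
    then have ee: "e * \<phi> d * e = 0" by (rule torsion)
    have "e * (\<phi> d * e + e * \<phi> d + d * \<phi> e + \<phi> e * d) * f = 0" by (simp only: eq) simp
    then have ef: "e * \<phi> d * f + e * \<phi> e * d = 0" by (simp add: algebra_simps)
    have "f * \<phi> e * d = 0" using d(1) by (simp add: mult.assoc)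
    then have "\<phi> e * d = e * \<phi> e * d" by (simp add: f_def algebra_simps)
    moreover have "e * \<phi> d = e * \<phi> d * e + e * \<phi> d * f"
      by (simp add: f_def algebra_simps)
    ultimately show ?thesis using ef ee by (simp add: add.commute)
  qed
  have "\<phi> (e * t) = \<phi> a + \<phi> b" using in_A by (simp add: et map_add)
  also have "\<dots> = \<phi> e * t + e * \<phi> t + - ((\<phi> e * c + e * \<phi> c) + (\<phi> e * d + e * \<phi> d))"
    using in_A by (subst 1, subst 2) (simp add: td map_add algebra_simps)
  finally show ?thesis by (simp add: 3 4)
qed

end
text \<open>Centrality turns every correction term into a multiple of \<open>x * y\<close> or
  \<open>y * x\<close>, both zero.\<close>

lemma (in orthogonal_map) normalized_orthogonal_map:
  assumes central: "\<And>t. t \<in> A \<Longrightarrow> \<phi> 1 * t = t * \<phi> 1"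
  shows "normalized_orthogonal_map A (\<lambda>x. \<phi> x - \<phi> 1 * x)"
proof unfold_locales
  fix x y assume xy: "x \<in> A" "y \<in> A" "x * y = 0" "y * x = 0"
  have *: "x * (\<phi> 1 * y) = \<phi> 1 * (x * y)" "y * (\<phi> 1 * x) = \<phi> 1 * (y * x)"
    by (simp_all add: central xy flip: mult.assoc)
  show "(\<phi> x - \<phi> 1 * x) * y + y * (\<phi> x - \<phi> 1 * x) + x * (\<phi> y - \<phi> 1 * y) + (\<phi> y - \<phi> 1 * y) * x = 0"
    using orthogonal[OF xy] by (simp add: left_diff_distrib right_diff_distrib * xy mult.assoc)
next
  show "x = 0" if "x + x = 0" for x :: 'a using that by (rule torsion)
qed (auto simp: map_add algebra_simps)

section \<open>Limits of decreasing nets of projections\<close>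

locale hilbert =
  fixes H :: "('h::ab_group_add) hspace"
  assumes hilbert: "complex_hilbert_space H"
begin

lemma
  sc_add_right: "sc H a (x + y) = sc H a x + sc H a y" and
  sc_add_left: "sc H (a + b) x = sc H a x + sc H b x" and
  sc_sc: "sc H a (sc H b x) = sc H (a * b) x" and
  sc_one [simp]: "sc H 1 x = x" and
  ip_add_left: "ip H (x + y) z = ip H x z + ip H y z" and
  ip_sc_left: "ip H (sc H a x) y = a * ip H x y" and
  ip_cnj: "ip H y x = cnj (ip H x y)" and
  ip_self: "Im (ip H x x) = 0" "0 \<le> Re (ip H x x)" and
  ip_definite: "ip H x x = 0 \<Longrightarrow> x = 0"
proof -
  note h = hilbert[unfolded complex_hilbert_space_def]
  from h show "sc H a (x + y) = sc H a x + sc H a y" by (elim conjE) fast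
  from h show "sc H (a + b) x = sc H a x + sc H b x" by (elim conjE) fast
  from h show "sc H a (sc H b x) = sc H (a * b) x" by (elim conjE) fast
  from h show "sc H 1 x = x" by (elim conjE) fast
  from h show "ip H (x + y) z = ip H x z + ip H y z" by (elim conjE) fast
  from h show "ip H (sc H a x) y = a * ip H x y" by (elim conjE) fast
  from h show "ip H y x = cnj (ip H x y)" by (elim conjE) fast
  from h show "Im (ip H x x) = 0" by (elim conjE) fast
  from h show "0 \<le> Re (ip H x x)" by (elim conjE) fast
  from h show "x = 0" if "ip H x x = 0" using that by (elim conjE) fast
qed

lemma complete:
  assumes "\<And>e. e > 0 \<Longrightarrow> \<exists>N. \<forall>m\<ge>N. \<forall>n\<ge>N. hnorm H (s m - s n) < e"
  obtains l where "\<And>e. e > 0 \<Longrightarrow> \<exists>N::nat. \<forall>n\<ge>N. hnorm H (s n - l) < e"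
proof -
  have "(\<forall>e>0. \<exists>N. \<forall>m\<ge>N. \<forall>n\<ge>N. hnorm H (s m - s n) < e) \<longrightarrow>
      (\<exists>l. \<forall>e>0. \<exists>N. \<forall>n\<ge>N. hnorm H (s n - l) < e)"
    using hilbert unfolding complex_hilbert_space_def by (elim conjE) (erule allE[of _ s], assumption)
  then show ?thesis using assms that by blast
qed

lemma sc_zero_right [simp]: "sc H a 0 = 0"
  using sc_add_right[of a 0 0] by simp

lemma sc_zero_left [simp]: "sc H 0 x = 0"
  using sc_add_left[of 0 0 x] by simp

lemma sc_minus_right: "sc H a (- x) = - sc H a x"
  using sc_add_right[of a x "- x"] by (simp add: eq_neg_iff_add_eq_0 add.commute)

lemma sc_minus_left: "sc H (- a) x = - sc H a x"
  using sc_add_left[of a "- a" x] by (simp add: eq_neg_iff_add_eq_0 add.commute)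

lemma ip_zero_left [simp]: "ip H 0 y = 0"
  using ip_add_left[of 0 0 y] by simp

lemma ip_minus_left: "ip H (- x) y = - ip H x y"
  using ip_add_left[of x "- x" y] by (simp add: eq_neg_iff_add_eq_0 add.commute)

lemma ip_diff_left: "ip H (x - y) z = ip H x z - ip H y z"
  using ip_add_left[of x "- y" z] by (simp add: ip_minus_left)

lemma ip_add_right: "ip H z (x + y) = ip H z x + ip H z y"
  by (simp add: ip_cnj[of z] ip_add_left)

lemma ip_diff_right: "ip H z (x - y) = ip H z x - ip H z y"
  by (simp add: ip_cnj[of z] ip_diff_left)

lemma ip_minus_right: "ip H y (- x) = - ip H y x"
  by (simp add: ip_cnj[of y] ip_minus_left)

lemma ip_sc_right: "ip H x (sc H a y) = cnj a * ip H x y"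
  by (simp add: ip_cnj[of x] ip_sc_left)

lemma ip_zero_right [simp]: "ip H y 0 = 0"
  by (simp add: ip_cnj[of y])

lemma hnorm_square: "(hnorm H x)\<^sup>2 = Re (ip H x x)"
  by (simp add: hnorm_def ip_self)

lemma ip_self_eq: "ip H x x = of_real ((hnorm H x)\<^sup>2)"
  by (simp add: hnorm_square complex_eq_iff ip_self)

lemma hnorm_nonneg [simp]: "0 \<le> hnorm H x"
  by (simp add: hnorm_def ip_self)

lemma hnorm_eq_zero: "hnorm H x = 0 \<Longrightarrow> x = 0"
  by (intro ip_definite) (simp add: ip_self_eq)

lemma hnorm_minus: "hnorm H (- x) = hnorm H x"
  by (simp add: hnorm_def ip_minus_left ip_minus_right)

lemma hnorm_minus_commute: "hnorm H (x - y) = hnorm H (y - x)"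
  using hnorm_minus[of "x - y"] by simp

lemma hnorm_sc: "hnorm H (sc H a x) = cmod a * hnorm H x"
proof -
  have "ip H (sc H a x) (sc H a x) = of_real ((cmod a * hnorm H x)\<^sup>2)"
    by (simp add: ip_sc_left ip_sc_right ip_self_eq[of x] power_mult_distrib complex_norm_square
        del: of_real_power)
  then have "(hnorm H (sc H a x))\<^sup>2 = (cmod a * hnorm H x)\<^sup>2"
    unfolding hnorm_square[of "sc H a x"] by (metis Re_complex_of_real)
  then show ?thesis by simp
qed

lemma cauchy_schwarz: "cmod (ip H x y) \<le> hnorm H x * hnorm H y"
proof (cases "y = 0")
  case False
  define n where "n = (hnorm H y)\<^sup>2"
  have n: "n > 0" using False hnorm_eq_zero[of y] by (auto simp: n_def)
  \<comment> \<open>The coefficient of the orthogonal projection of \<open>x\<close> onto the line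
    of \<open>y\<close>; the inequality is nonnegativity of the squared distance to that
    line.\<close>
  define c where "c = ip H x y / of_real n"
  have "ip H (x - sc H c y) (x - sc H c y) = of_real ((hnorm H x)\<^sup>2) - of_real ((cmod (ip H x y))\<^sup>2 / n)"
    using n by (simp add: ip_diff_left ip_diff_right ip_sc_left ip_sc_right ip_self_eq[of x]
        ip_self_eq[of y] ip_cnj[of y x] c_def complex_norm_square del: of_real_power flip: n_def)
  then have "0 \<le> (hnorm H x)\<^sup>2 - (cmod (ip H x y))\<^sup>2 / n"
    using ip_self(2)[of "x - sc H c y"] by (metis Re_complex_of_real of_real_diff)
  then have "(cmod (ip H x y))\<^sup>2 \<le> (hnorm H x * hnorm H y)\<^sup>2"
    using n by (simp add: field_simps power_mult_distrib n_def)
  then show ?thesis by (rule power2_le_imp_le) simp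
qed simp

lemma hnorm_triangle: "hnorm H (x + y) \<le> hnorm H x + hnorm H y"
proof -
  have "(hnorm H (x + y))\<^sup>2 = (hnorm H x)\<^sup>2 + (hnorm H y)\<^sup>2 + 2 * Re (ip H x y)"
    by (simp add: hnorm_square ip_add_left ip_add_right ip_cnj[of y x])
  also have "Re (ip H x y) \<le> hnorm H x * hnorm H y"
    using complex_Re_le_cmod cauchy_schwarz order_trans by blast
  finally have "(hnorm H (x + y))\<^sup>2 \<le> (hnorm H x + hnorm H y)\<^sup>2"
    by (simp add: power2_sum)
  then show ?thesis by (rule power2_le_imp_le) simp
qed

lemma hnorm_triangle_diff: "hnorm H (x - z) \<le> hnorm H (x - y) + hnorm H (y - z)"
  using hnorm_triangle[of "x - y" "y - z"] by simp

text \<open>The factor \<open>c\<close> lets limit arguments end with bounds such as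
  \<open>2 * e\<close> without choosing a smaller \<open>e\<close> beforehand.\<close>

lemma eq_if_arbitrarily_close:
  assumes "\<And>e. e > 0 \<Longrightarrow> hnorm H (x - y) \<le> c * e" "0 < c"
  shows "x = y"
proof -
  have "hnorm H (x - y) \<le> e" if "e > 0" for e
    using assms(1)[of "e / c"] assms(2) that by simp
  then have "hnorm H (x - y) \<le> 0"
    by (rule dense_ge)
  then show ?thesis using hnorm_eq_zero[of "x - y"] hnorm_nonneg[of "x - y"] by simp
qed

lemma
  assumes "bounded_op H T"
  shows op_plus: "T (x + y) = T x + T y" and op_sc: "T (sc H a x) = sc H a (T x)"
  using assms by (auto simp: bounded_op_def)

lemma op_bound:
  assumes "bounded_op H T" obtains K where "0 \<le> K" "\<And>x. hnorm H (T x) \<le> K * hnorm H x"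
proof -
  obtain K where K: "hnorm H (T x) \<le> K * hnorm H x" for x
    using assms by (auto simp: bounded_op_def)
  have "hnorm H (T x) \<le> max 0 K * hnorm H x" for x
    using K[of x] by (smt (verit) hnorm_nonneg mult_right_mono)
  then show ?thesis using that[of "max 0 K"] by simp
qed

lemma op_0: "bounded_op H T \<Longrightarrow> T 0 = 0"
  using op_plus[of T 0 0] by simp

lemma op_minus: "bounded_op H T \<Longrightarrow> T (- x) = - T x"
  using op_plus[of T x "- x"] op_0[of T] by (simp add: eq_neg_iff_add_eq_0 add.commute)

lemma op_diff: "bounded_op H T \<Longrightarrow> T (x - y) = T x - T y"
  using op_plus[of T x "- y"] op_minus[of T y] by simp

lemma
  assumes "projection H P"
  shows projection_op: "bounded_op H P" and projection_idem: "P (P x) = P x"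
    and projection_adjoint: "ip H (P x) y = ip H x (P y)"
  using assms by (auto simp: projection_def fun_eq_iff)

lemma projection_pythagoras:
  assumes P: "projection H P"
  shows "(hnorm H (x - P x))\<^sup>2 = (hnorm H x)\<^sup>2 - (hnorm H (P x))\<^sup>2"
proof -
  have "ip H (P x) x = ip H (P x) (P x)" "ip H x (P x) = ip H (P x) (P x)"
    using projection_adjoint[OF P, of "P x" x] projection_adjoint[OF P, of x "P x"]
    by (simp_all add: projection_idem[OF P])
  then show ?thesis
    by (simp add: hnorm_square ip_diff_left ip_diff_right)
qed

lemma projection_contraction: "projection H P \<Longrightarrow> hnorm H (P x) \<le> hnorm H x"
  by (rule power2_le_imp_le)
    (use projection_pythagoras[of P x] zero_le_power2[of "hnorm H (x - P x)"] in simp_all)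

lemma projection_eqI:
  assumes P: "projection H P" and Q: "projection H Q" and PQ: "\<And>x. P (Q x) = Q x" and QP: "\<And>x. Q (P x) = P x"
  shows "P = Q"
proof
  fix x
  have "ip H (P x) z = ip H (Q x) z" for z
    using projection_adjoint[OF Q, of "P x" z] projection_adjoint[OF P, of x "Q z"]
      projection_adjoint[OF Q, of x z] by (simp add: PQ QP)
  then have "ip H (P x - Q x) z = 0" for z by (simp add: ip_diff_left)
  then show "P x = Q x" using ip_definite[of "P x - Q x"] by simp
qed

lemma projection_composition_idem:
  assumes "projection H P" "projection H Q" "P \<circ> Q = Q \<circ> P"
  shows "P (P (Q x)) = P (Q x)" "Q (P (Q x)) = P (Q x)"
  using assms by (metis comp_apply projection_idem)+

text \<open>A decreasing net of projections is Cauchy at each vector: by Pythagoras the distance of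
  two members is controlled by the decrease of the norms.\<close>
lemma commuting_projections_converge:
  assumes proj: "\<And>P. P \<in> S \<Longrightarrow> projection H P" and ne: "S \<noteq> {}"
    and comp: "\<And>P Q. P \<in> S \<Longrightarrow> Q \<in> S \<Longrightarrow> P \<circ> Q \<in> S"
    and comm: "\<And>P Q. P \<in> S \<Longrightarrow> Q \<in> S \<Longrightarrow> P \<circ> Q = Q \<circ> P"
  shows "\<exists>l. \<forall>e>0. \<exists>P\<in>S. \<forall>Q\<in>S. P \<circ> Q = Q \<longrightarrow> hnorm H (Q x - l) < e"
proof -
  \<comment> \<open>The limit of the squared norms along the net; the sequence \<open>p\<close>
    below nearly attains it, with an error that is a square so that distances are bounded by
    \<open>1 / Suc n\<close>.\<close>
  define r where "r = (INF P\<in>S. (hnorm H (P x))\<^sup>2)"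
  have bdd: "bdd_below ((\<lambda>P. (hnorm H (P x))\<^sup>2) ` S)" by (rule bdd_belowI2[of _ 0]) simp
  have r_le: "r \<le> (hnorm H (P x))\<^sup>2" if "P \<in> S" for P
    unfolding r_def using bdd that by (rule cINF_lower)
  have "\<exists>P\<in>S. (hnorm H (P x))\<^sup>2 < r + (1 / Suc n)\<^sup>2" for n
  proof (rule ccontr)
    assume "\<not> ?thesis"
    then have "r + (1 / Suc n)\<^sup>2 \<le> r"
      unfolding r_def using ne by (intro cINF_greatest) (auto simp: not_less)
    moreover have "0 < (1 / real (Suc n))\<^sup>2" by (rule zero_less_power) simp
    ultimately show False by linarith
  qed
  then obtain p where p: "p n \<in> S" "(hnorm H (p n x))\<^sup>2 < r + (1 / Suc n)\<^sup>2" for n by metis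
  have below: "hnorm H (p n x - Q x) < 1 / Suc n" if Q: "Q \<in> S" "p n \<circ> Q = Q" for n Q
  proof -
    have "Q (p n x) = Q x" using comm[OF p(1) Q(1)] Q(2) by (metis comp_apply)
    then have "(hnorm H (p n x - Q x))\<^sup>2 = (hnorm H (p n x))\<^sup>2 - (hnorm H (Q x))\<^sup>2"
      using projection_pythagoras[OF proj[OF Q(1)], of "p n x"] by simp
    also have "\<dots> < (1 / Suc n)\<^sup>2" using p(2)[of n] r_le[OF Q(1)] by simp
    finally show ?thesis by (rule power2_less_imp_less) simp
  qed
  have "\<exists>N. \<forall>m\<ge>N. \<forall>n\<ge>N. hnorm H (p m x - p n x) < e" if "e > 0" for e
  proof -
    obtain N where N: "1 / real (Suc N) < e / 2"
      using nat_approx_posE[of "e / 2"] \<open>e > 0\<close> by auto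
    have "hnorm H (p m x - p n x) < e" if "m \<ge> N" "n \<ge> N" for m n
    proof -
      \<comment> \<open>\<open>p m\<close> and \<open>p n\<close> need not be comparable, but their
        product lies below both and is close to each.\<close>
      let ?Q = "p m \<circ> p n"
      have Q: "?Q \<in> S" using comp p by blast
      have "p m \<circ> ?Q = ?Q" "p n \<circ> ?Q = ?Q"
        using projection_composition_idem[OF proj proj comm, OF p(1) p(1) p(1) p(1)] by auto
      then have "hnorm H (p m x - ?Q x) < 1 / Suc m" "hnorm H (p n x - ?Q x) < 1 / Suc n"
        using below[OF Q] by blast+
      moreover have "1 / real (Suc m) \<le> 1 / Suc N" "1 / real (Suc n) \<le> 1 / Suc N"
        using that by (simp_all add: frac_le)
      ultimately show ?thesis
        using hnorm_triangle_diff[of "p m x" "p n x" "?Q x"] hnorm_minus_commute[of "p n x" "?Q x"] N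
        by linarith
    qed
    then show ?thesis by blast
  qed
  then obtain l where l: "\<And>e. e > 0 \<Longrightarrow> \<exists>N::nat. \<forall>n\<ge>N. hnorm H (p n x - l) < e"
    using complete[of "\<lambda>n. p n x"] by blast
  have "\<exists>P\<in>S. \<forall>Q\<in>S. P \<circ> Q = Q \<longrightarrow> hnorm H (Q x - l) < e" if "e > 0" for e
  proof -
    obtain M where M: "\<And>n. n \<ge> M \<Longrightarrow> hnorm H (p n x - l) < e / 2"
      using l[of "e / 2"] \<open>e > 0\<close> by auto
    obtain N where N: "1 / real (Suc N) < e / 2"
      using nat_approx_posE[of "e / 2"] \<open>e > 0\<close> by auto
    let ?n = "max M N"
    have "hnorm H (Q x - l) < e" if "Q \<in> S" "p ?n \<circ> Q = Q" for Q
    proof -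
      have "1 / real (Suc ?n) \<le> 1 / Suc N" by (simp add: frac_le)
      then show ?thesis
        using hnorm_triangle_diff[of "Q x" l "p ?n x"] hnorm_minus_commute[of "p ?n x" "Q x"] N
          M[of ?n] below[OF that] by linarith
    qed
    then show ?thesis using p(1) by blast
  qed
  then show ?thesis by blast
qed

text \<open>Composition directs \<open>S\<close> downwards, and \<open>M\<close> is the strong
  limit, that is, the projection onto the intersection of the ranges. The approximation on finite
  sets has the shape of the premise of \<open>strongly_closed\<close>, so that \<open>M\<close> can
  be placed in a lattice.\<close>

lemma commuting_projections_limit:
  assumes proj: "\<And>P. P \<in> S \<Longrightarrow> projection H P" and ne: "S \<noteq> {}"
    and comp: "\<And>P Q. P \<in> S \<Longrightarrow> Q \<in> S \<Longrightarrow> P \<circ> Q \<in> S"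
    and comm: "\<And>P Q. P \<in> S \<Longrightarrow> Q \<in> S \<Longrightarrow> P \<circ> Q = Q \<circ> P"
  obtains M where "projection H M" "\<And>P x. P \<in> S \<Longrightarrow> P (M x) = M x"
    "\<And>F e. finite F \<Longrightarrow> e > 0 \<Longrightarrow> \<exists>P\<in>S. \<forall>x\<in>F. hnorm H (M x - P x) < e"
    "\<And>x. (\<And>P. P \<in> S \<Longrightarrow> P x = x) \<Longrightarrow> M x = x"
proof -
  obtain M where M: "e > 0 \<Longrightarrow> \<exists>P\<in>S. \<forall>Q\<in>S. P \<circ> Q = Q \<longrightarrow> hnorm H (Q x - M x) < e" for x e
    using commuting_projections_converge[OF assms] by metis
  \<comment> \<open>Thresholds for single vectors are combined by composing the projections, since
    whatever lies below the product lies below each factor.\<close>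
  have simult: "\<exists>P\<in>S. \<forall>Q\<in>S. P \<circ> Q = Q \<longrightarrow> (\<forall>x\<in>F. hnorm H (Q x - M x) < e)"
    if "finite F" "e > 0" for F e
    using that(1)
  proof induction
    case empty
    then show ?case using ne by blast
  next
    case (insert x F)
    obtain P where P: "P \<in> S" "\<And>Q. Q \<in> S \<Longrightarrow> P \<circ> Q = Q \<Longrightarrow> \<forall>x\<in>F. hnorm H (Q x - M x) < e"
      using insert.IH by blast
    obtain R where R: "R \<in> S" "\<And>Q. Q \<in> S \<Longrightarrow> R \<circ> Q = Q \<Longrightarrow> hnorm H (Q x - M x) < e"
      using M[OF \<open>e > 0\<close>, of x] by blast
    have "\<forall>y\<in>insert x F. hnorm H (Q y - M y) < e" if Q: "Q \<in> S" "P \<circ> R \<circ> Q = Q" for Q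
    proof -
      have "P \<circ> Q = Q" "R \<circ> Q = Q"
        using projection_composition_idem[OF proj proj comm, OF P(1) R(1) P(1) R(1)] Q(2)
        by (metis comp_apply ext)+
      then show ?thesis using P(2) R(2) Q(1) by blast
    qed
    then show ?case using comp[OF P(1) R(1)] by blast
  qed
  have near: "\<exists>Q\<in>S. P \<circ> Q = Q \<and> (\<forall>x\<in>F. hnorm H (Q x - M x) < e)"
    if F: "finite F" "e > 0" and P: "P \<in> S" for F e P
  proof -
    obtain R where R: "R \<in> S" "\<And>Q. Q \<in> S \<Longrightarrow> R \<circ> Q = Q \<Longrightarrow> \<forall>x\<in>F. hnorm H (Q x - M x) < e"
      using simult[OF F] by blast
    have "P \<circ> (P \<circ> R) = P \<circ> R" "R \<circ> (P \<circ> R) = P \<circ> R"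
      using projection_composition_idem[OF proj proj comm, OF P R(1) P R(1)] by auto
    then show ?thesis using comp[OF P R(1)] R(2) by blast
  qed
  obtain P0 where P0: "P0 \<in> S" using ne by blast
  have below: "P (M x) = M x" if P: "P \<in> S" for P x
  proof (rule eq_if_arbitrarily_close)
    fix e :: real assume "e > 0"
    then obtain Q where Q: "Q \<in> S" "P \<circ> Q = Q" "hnorm H (Q x - M x) < e"
      using near[of "{x}" e P] P by auto
    have eq: "P (M x) - M x = P (M x - Q x) + (Q x - M x)"
      using op_diff[OF projection_op[OF proj[OF P]]] Q(2) by (simp add: fun_eq_iff)
    show "hnorm H (P (M x) - M x) \<le> 2 * e"
      unfolding eq
      using hnorm_triangle[of "P (M x - Q x)" "Q x - M x"] Q(3)
        projection_contraction[OF proj[OF P], of "M x - Q x"] hnorm_minus_commute[of "M x" "Q x"]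
      by linarith
  qed simp
  have fixed: "M x = x" if "\<And>P. P \<in> S \<Longrightarrow> P x = x" for x
  proof (rule eq_if_arbitrarily_close)
    fix e :: real assume "e > 0"
    then obtain Q where Q: "Q \<in> S" "hnorm H (Q x - M x) < e"
      using near[of "{x}" e P0] P0 by auto
    then show "hnorm H (M x - x) \<le> 1 * e"
      using that[OF Q(1)] hnorm_minus_commute[of "M x" x] by simp
  qed simp
  have add: "M (x + y) = M x + M y" for x y
  proof (rule eq_if_arbitrarily_close)
    fix e :: real assume "e > 0"
    then obtain Q where Q: "Q \<in> S" "\<forall>z\<in>{x, y, x + y}. hnorm H (Q z - M z) < e"
      using near[of "{x, y, x + y}" e P0] P0 by auto
    have "M (x + y) - (M x + M y) = - (Q (x + y) - M (x + y)) + ((Q x - M x) + (Q y - M y))"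
      using op_plus[OF projection_op[OF proj[OF Q(1)]]] by simp
    then have "hnorm H (M (x + y) - (M x + M y)) \<le>
        hnorm H (Q (x + y) - M (x + y)) + (hnorm H (Q x - M x) + hnorm H (Q y - M y))"
      by (metis hnorm_triangle hnorm_minus add_left_mono order_trans)
    then show "hnorm H (M (x + y) - (M x + M y)) \<le> 3 * e" using Q(2) by simp
  qed simp
  have scale: "M (sc H a x) = sc H a (M x)" for a x
  proof (rule eq_if_arbitrarily_close)
    fix e :: real assume "e > 0"
    then obtain Q where Q: "Q \<in> S" "\<forall>z\<in>{x, sc H a x}. hnorm H (Q z - M z) < e"
      using near[of "{x, sc H a x}" e P0] P0 by auto
    have "M (sc H a x) - sc H a (M x) = - (Q (sc H a x) - M (sc H a x)) + sc H a (Q x - M x)"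
      using op_sc[OF projection_op[OF proj[OF Q(1)]]] sc_add_right[of a "Q x" "- M x"]
      by (simp add: sc_minus_right)
    then have "hnorm H (M (sc H a x) - sc H a (M x)) \<le>
        hnorm H (Q (sc H a x) - M (sc H a x)) + cmod a * hnorm H (Q x - M x)"
      by (metis hnorm_triangle hnorm_minus hnorm_sc)
    also have "\<dots> \<le> e + cmod a * e"
      using Q(2) by (intro add_mono mult_left_mono) auto
    finally show "hnorm H (M (sc H a x) - sc H a (M x)) \<le> (1 + cmod a) * e"
      by (simp add: algebra_simps)
  qed (simp add: add_pos_nonneg)
  have contr: "hnorm H (M x) \<le> 1 * hnorm H x" for x
  proof -
    have "hnorm H (M x) \<le> hnorm H x + e" if "e > 0" for e
    proof -
      obtain Q where Q: "Q \<in> S" "hnorm H (Q x - M x) < e"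
        using near[of "{x}" e P0] P0 \<open>e > 0\<close> by auto
      then show ?thesis
        using hnorm_triangle_diff[of "M x" 0 "Q x"] hnorm_minus_commute[of "M x" "Q x"]
          projection_contraction[OF proj[OF Q(1)], of x] by simp
    qed
    then show ?thesis by (simp add: field_le_epsilon)
  qed
  have adj: "ip H (M x) y = ip H x (M y)" for x y
  proof -
    have "cmod (ip H (M x) y - ip H x (M y)) \<le> e" if "e > 0" for e
    proof -
      \<comment> \<open>Scaled so that the two Cauchy-Schwarz terms add up to at most
        \<open>e\<close>; the summand 1 keeps the denominator positive.\<close>
      define d where "d = e / (1 + hnorm H x + hnorm H y)"
      have pos: "1 + hnorm H x + hnorm H y > 0"
        using hnorm_nonneg[of x] hnorm_nonneg[of y] by linarith
      then have "d > 0" using \<open>e > 0\<close> by (simp add: d_def)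
      then obtain Q where Q: "Q \<in> S" "\<forall>z\<in>{x, y}. hnorm H (Q z - M z) < d"
        using near[of "{x, y}" d P0] P0 by auto
      have eq: "ip H (M x) y - ip H x (M y) = ip H x (Q y - M y) - ip H (Q x - M x) y"
        using projection_adjoint[OF proj[OF Q(1)], of x y] by (simp add: ip_diff_left ip_diff_right)
      have "cmod (ip H (M x) y - ip H x (M y)) \<le>
          hnorm H x * hnorm H (Q y - M y) + hnorm H (Q x - M x) * hnorm H y"
        unfolding eq using norm_triangle_ineq4[of "ip H x (Q y - M y)" "ip H (Q x - M x) y"]
          cauchy_schwarz[of x "Q y - M y"] cauchy_schwarz[of "Q x - M x" y] by linarith
      also have "\<dots> \<le> hnorm H x * d + d * hnorm H y"
        using Q(2) by (intro add_mono mult_left_mono mult_right_mono) auto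
      also have "\<dots> \<le> d * (1 + hnorm H x + hnorm H y)"
        using \<open>d > 0\<close> by (simp add: algebra_simps)
      also have "\<dots> = e" using pos by (simp add: d_def)
      finally show ?thesis .
    qed
    then have "cmod (ip H (M x) y - ip H x (M y)) \<le> 0" by (rule dense_ge)
    then show ?thesis by simp
  qed
  have idem: "M (M x) = M x" for x using below by (rule fixed)
  have "\<exists>K. \<forall>x. hnorm H (M x) \<le> K * hnorm H x" using contr by blast
  then have "projection H M"
    unfolding projection_def bounded_op_def using add scale adj idem by (auto simp: fun_eq_iff)
  moreover have "\<exists>P\<in>S. \<forall>x\<in>F. hnorm H (M x - P x) < e" if "finite F" "e > 0" for F e
    using near[OF that P0] by (auto simp: hnorm_minus_commute)
  ultimately show thesis using that below fixed by blast
qed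

end

section \<open>The lattice of a CDCSL algebra\<close>

context hilbert
begin

lemma bounded_op_add:
  assumes "bounded_op H S" "bounded_op H T" shows "bounded_op H (op_add S T)"
proof -
  obtain K1 K2 where "\<And>x. hnorm H (S x) \<le> K1 * hnorm H x" "\<And>x. hnorm H (T x) \<le> K2 * hnorm H x"
    using op_bound[OF assms(1)] op_bound[OF assms(2)] by metis
  then have "hnorm H (S x + T x) \<le> (K1 + K2) * hnorm H x" for x
    using hnorm_triangle[of "S x" "T x"] by (smt (verit) distrib_right)
  then have "\<exists>K. \<forall>x. hnorm H (S x + T x) \<le> K * hnorm H x" by blast
  then show ?thesis
    unfolding bounded_op_def op_add_def
    by (simp add: op_plus[OF assms(1)] op_plus[OF assms(2)] op_sc[OF assms(1)] op_sc[OF assms(2)] sc_add_right)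
qed

lemma bounded_op_compose:
  assumes "bounded_op H S" "bounded_op H T" shows "bounded_op H (S \<circ> T)"
proof -
  obtain K1 where K1: "0 \<le> K1" "\<And>x. hnorm H (S x) \<le> K1 * hnorm H x" using op_bound[OF assms(1)] by blast
  obtain K2 where K2: "\<And>x. hnorm H (T x) \<le> K2 * hnorm H x" using op_bound[OF assms(2)] by metis
  have "hnorm H (S (T x)) \<le> K1 * K2 * hnorm H x" for x
    using K1(2)[of "T x"] mult_left_mono[OF K2[of x] K1(1)] by (simp add: mult.assoc)
  then have "\<exists>K. \<forall>x. hnorm H (S (T x)) \<le> K * hnorm H x" by blast
  then show ?thesis
    unfolding bounded_op_def
    by (simp add: op_plus[OF assms(1)] op_plus[OF assms(2)] op_sc[OF assms(1)] op_sc[OF assms(2)])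
qed

lemma bounded_op_smult:
  assumes "bounded_op H T" shows "bounded_op H (op_smult H c T)"
proof -
  obtain K where "\<And>x. hnorm H (T x) \<le> K * hnorm H x" using op_bound[OF assms] by metis
  then have "hnorm H (sc H c (T x)) \<le> cmod c * K * hnorm H x" for x
    by (simp add: hnorm_sc mult.assoc mult_left_mono)
  then have "\<exists>K. \<forall>x. hnorm H (sc H c (T x)) \<le> K * hnorm H x" by blast
  then show ?thesis
    unfolding bounded_op_def op_smult_def
    by (simp add: op_plus[OF assms] op_sc[OF assms] sc_add_right sc_sc mult.commute)
qed

lemma bounded_op_id: "bounded_op H id"
  unfolding bounded_op_def by (auto intro: exI[of _ 1])

definition cmpl :: "('h \<Rightarrow> 'h) \<Rightarrow> 'h \<Rightarrow> 'h" where "cmpl P = (\<lambda>x. x - P x)"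

lemma projection_cmpl:
  assumes P: "projection H P" shows "projection H (cmpl P)"
proof -
  have "cmpl P = op_add id (op_smult H (- 1) P)"
    by (simp add: cmpl_def op_add_def op_smult_def sc_minus_left fun_eq_iff)
  then have "bounded_op H (cmpl P)"
    using bounded_op_add bounded_op_smult bounded_op_id projection_op[OF P] by metis
  then show ?thesis
    unfolding projection_def
    by (auto simp: cmpl_def fun_eq_iff op_diff[OF projection_op[OF P]] projection_idem[OF P]
        ip_diff_left ip_diff_right projection_adjoint[OF P])
qed

lemma cmpl_cmpl [simp]: "cmpl (cmpl P) = P"
  by (simp add: cmpl_def)

lemma projection_compose:
  assumes P: "projection H P" and Q: "projection H Q" and "P \<circ> Q = Q \<circ> P"
  shows "projection H (P \<circ> Q)"
proof -
  have c: "P (Q x) = Q (P x)" for x using assms(3) by (metis comp_apply)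
  show ?thesis
    unfolding projection_def
    using bounded_op_compose[OF projection_op[OF P] projection_op[OF Q]]
    by (auto simp: fun_eq_iff projection_adjoint[OF P] projection_adjoint[OF Q]
        projection_idem[OF P] projection_idem[OF Q] c)
qed

text \<open>The two products are adjoint to each other.\<close>

lemma projection_orthogonal_sym:
  assumes P: "projection H P" and Q: "projection H Q" and "\<And>x. P (Q x) = 0"
  shows "Q (P x) = 0"
proof -
  have "ip H (Q (P x)) (Q (P x)) = ip H x (P (Q (Q (P x))))"
    by (simp add: projection_adjoint[OF P] projection_adjoint[OF Q])
  also have "\<dots> = 0" using assms(3) by simp
  finally show ?thesis by (rule ip_definite)
qed

lemma proj_le_iff: "proj_le P Q \<longleftrightarrow> (\<forall>x. Q (P x) = P x)"
  by (simp add: proj_le_def fun_eq_iff)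

text \<open>\<open>P \<le> Q\<close> means that \<open>cmpl Q\<close> kills the range of
  \<open>P\<close>, a symmetric relation by \<open>projection_orthogonal_sym\<close>. Reversing the
  order is what reduces suprema to decreasing nets.\<close>

lemma proj_le_cmpl:
  assumes P: "projection H P" and Q: "projection H Q" and "proj_le P Q"
  shows "proj_le (cmpl Q) (cmpl P)"
proof -
  have "cmpl Q (P x) = 0" for x using assms(3) by (simp add: proj_le_iff cmpl_def)
  then have "P (cmpl Q x) = 0" for x by (rule projection_orthogonal_sym[OF projection_cmpl[OF Q] P])
  then show ?thesis by (simp add: proj_le_iff cmpl_def[of P])
qed

text \<open>\<open>proj_inf\<close> is a definite description, so uniqueness is needed; it is
  antisymmetry of \<open>proj_le\<close>. The competitors \<open>R\<close> range over all
  projections, not only over those of a lattice.\<close>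

lemma proj_inf_eqI:
  assumes "projection H M" "\<And>Q. Q \<in> S \<Longrightarrow> proj_le M Q"
    "\<And>R. projection H R \<Longrightarrow> (\<And>Q. Q \<in> S \<Longrightarrow> proj_le R Q) \<Longrightarrow> proj_le R M"
  shows "proj_inf H S = M"
  unfolding proj_inf_def
proof (rule the_equality)
  fix P assume P: "projection H P \<and> (\<forall>Q\<in>S. proj_le P Q) \<and>
    (\<forall>R. projection H R \<and> (\<forall>Q\<in>S. proj_le R Q) \<longrightarrow> proj_le R P)"
  then have "proj_le P M" "proj_le M P" using assms by auto
  then show "P = M" using projection_eqI[of P M] P assms(1) by (simp add: proj_le_iff)
qed (use assms in auto)

lemma proj_sup_eqI:
  assumes "projection H M" "\<And>Q. Q \<in> S \<Longrightarrow> proj_le Q M"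
    "\<And>R. projection H R \<Longrightarrow> (\<And>Q. Q \<in> S \<Longrightarrow> proj_le Q R) \<Longrightarrow> proj_le M R"
  shows "proj_sup H S = M"
  unfolding proj_sup_def
proof (rule the_equality)
  fix P assume P: "projection H P \<and> (\<forall>Q\<in>S. proj_le Q P) \<and>
    (\<forall>R. projection H R \<and> (\<forall>Q\<in>S. proj_le Q R) \<longrightarrow> proj_le P R)"
  then have "proj_le P M" "proj_le M P" using assms by auto
  then show "P = M" using projection_eqI[of P M] P assms(1) by (simp add: proj_le_iff)
qed (use assms in auto)

lemma proj_inf_pair:
  assumes P: "projection H P" and Q: "projection H Q" and c: "P \<circ> Q = Q \<circ> P"
  shows "proj_inf H {P, Q} = P \<circ> Q"
proof (rule proj_inf_eqI)
  show "projection H (P \<circ> Q)" using assms by (rule projection_compose)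
  show "proj_le (P \<circ> Q) R" if "R \<in> {P, Q}" for R
    using that projection_composition_idem[OF P Q c] by (auto simp: proj_le_iff)
  show "proj_le R (P \<circ> Q)" if "\<And>S. S \<in> {P, Q} \<Longrightarrow> proj_le R S" for R
    using that[of P] that[of Q] by (simp add: proj_le_iff)
qed

text \<open>De Morgan; the right side is \<open>P + Q - P Q\<close>.\<close>

lemma proj_sup_pair:
  assumes P: "projection H P" and Q: "projection H Q" and c: "P \<circ> Q = Q \<circ> P"
  shows "proj_sup H {P, Q} = cmpl (cmpl P \<circ> cmpl Q)"
proof (rule proj_sup_eqI)
  note cP = projection_cmpl[OF P] and cQ = projection_cmpl[OF Q]
  have c': "P (Q x) = Q (P x)" for x using c by (metis comp_apply)
  have cc: "cmpl P \<circ> cmpl Q = cmpl Q \<circ> cmpl P"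
    by (simp add: cmpl_def fun_eq_iff op_diff[OF projection_op[OF P]] op_diff[OF projection_op[OF Q]] c')
  show "projection H (cmpl (cmpl P \<circ> cmpl Q))"
    by (rule projection_cmpl[OF projection_compose[OF cP cQ cc]])
  have expand: "cmpl (cmpl P \<circ> cmpl Q) x = P x + Q x - P (Q x)" for x
    by (simp add: cmpl_def op_diff[OF projection_op[OF P]])
  show "proj_le R (cmpl (cmpl P \<circ> cmpl Q))" if "R \<in> {P, Q}" for R
    using that by (auto simp: proj_le_iff expand projection_idem[OF P] projection_idem[OF Q] c')
  fix R assume R: "projection H R" "\<And>S. S \<in> {P, Q} \<Longrightarrow> proj_le S R"
  show "proj_le (cmpl (cmpl P \<circ> cmpl Q)) R"
    using R(2) by (simp add: proj_le_iff expand op_diff[OF projection_op[OF R(1)]]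
        op_plus[OF projection_op[OF R(1)]])
qed

end

section \<open>Completeness of the lattice and complete distributivity\<close>

locale cdcsl = hilbert H for H :: "('h::ab_group_add) hspace" +
  fixes L :: "('h \<Rightarrow> 'h) set"
  assumes cdcsl: "CDCSL H L"
begin

lemma
  shows L_projection: "P \<in> L \<Longrightarrow> projection H P"
    and L_zero: "op_zero \<in> L" and L_id: "id \<in> L"
    and L_commute: "P \<in> L \<Longrightarrow> Q \<in> L \<Longrightarrow> P \<circ> Q = Q \<circ> P"
    and L_sup_pair: "P \<in> L \<Longrightarrow> Q \<in> L \<Longrightarrow> proj_sup H {P, Q} \<in> L"
    and L_inf_pair: "P \<in> L \<Longrightarrow> Q \<in> L \<Longrightarrow> proj_inf H {P, Q} \<in> L"
    and L_strongly_closed: "strongly_closed H L"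
    and L_distributive: "completely_distributive H L"
  using cdcsl unfolding CDCSL_def by auto

lemma L_closed:
  assumes "bounded_op H T" "\<And>F e. finite F \<Longrightarrow> e > 0 \<Longrightarrow> \<exists>P\<in>L. \<forall>x\<in>F. hnorm H (T x - P x) < e"
  shows "T \<in> L"
  using L_strongly_closed assms unfolding strongly_closed_def by blast

lemma L_compose: "P \<in> L \<Longrightarrow> Q \<in> L \<Longrightarrow> P \<circ> Q \<in> L"
  using L_inf_pair proj_inf_pair[OF L_projection L_projection L_commute] by metis

lemma L_cmpl_compose: "P \<in> L \<Longrightarrow> Q \<in> L \<Longrightarrow> cmpl (cmpl P \<circ> cmpl Q) \<in> L"
  using L_sup_pair proj_sup_pair[OF L_projection L_projection L_commute] by metis

text \<open>\<open>CDCSL\<close> provides binary meets only; arbitrary ones are strong limits of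
  decreasing nets inside \<open>L\<close>.\<close>

lemma L_inf:
  assumes S: "S \<subseteq> L"
  shows "proj_inf H S \<in> L" "P \<in> S \<Longrightarrow> proj_le (proj_inf H S) P"
    "(\<And>P. P \<in> S \<Longrightarrow> P x = x) \<Longrightarrow> proj_inf H S x = x"
proof -
  \<comment> \<open>An enlargement of \<open>S\<close> that is closed under composition and has the
    same common fixed vectors. It contains \<open>id\<close>, hence is nonempty even if
    \<open>S\<close> is empty.\<close>
  define D where "D = {Q \<in> L. \<forall>x. (\<forall>P\<in>S. P x = x) \<longrightarrow> Q x = x}"
  have SD: "S \<subseteq> D" and "id \<in> D" using S L_id by (auto simp: D_def)
  obtain M where M: "projection H M" "\<And>P x. P \<in> D \<Longrightarrow> P (M x) = M x"
    "\<And>F e. finite F \<Longrightarrow> e > 0 \<Longrightarrow> \<exists>P\<in>D. \<forall>x\<in>F. hnorm H (M x - P x) < e"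
    "\<And>x. (\<And>P. P \<in> D \<Longrightarrow> P x = x) \<Longrightarrow> M x = x"
  proof (rule commuting_projections_limit[of D])
    show "P \<circ> Q \<in> D" if "P \<in> D" "Q \<in> D" for P Q
      using that L_compose by (auto simp: D_def)
  qed (use \<open>id \<in> D\<close> L_projection L_commute in \<open>auto simp: D_def\<close>)
  have fixed: "M x = x" if "\<And>P. P \<in> S \<Longrightarrow> P x = x" for x
    using M(4)[of x] that by (auto simp: D_def)
  have lower: "proj_le M P" if "P \<in> S" for P using M(2) SD that by (auto simp: proj_le_iff)
  have inf: "proj_inf H S = M"
    by (rule proj_inf_eqI) (use M(1) lower fixed in \<open>auto simp: proj_le_iff\<close>)
  have "D \<subseteq> L" by (auto simp: D_def)
  then have "M \<in> L" using M(3) by (intro L_closed projection_op[OF M(1)]) blast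
  then show "proj_inf H S \<in> L" "P \<in> S \<Longrightarrow> proj_le (proj_inf H S) P"
    "(\<And>P. P \<in> S \<Longrightarrow> P x = x) \<Longrightarrow> proj_inf H S x = x"
    using lower fixed unfolding inf by auto
qed

text \<open>The limit is taken over complements and complemented back at the end, as
  \<open>L\<close> itself need not be closed under complements.\<close>

lemma L_sup:
  assumes S: "S \<subseteq> L"
  shows "proj_sup H S \<in> L" "P \<in> S \<Longrightarrow> proj_le P (proj_sup H S)"
    "projection H R \<Longrightarrow> (\<And>P. P \<in> S \<Longrightarrow> proj_le P R) \<Longrightarrow> proj_le (proj_sup H S) R"
proof -
  \<comment> \<open>Upper bounds are arbitrary projections, which need not commute with
    \<open>L\<close>. \<open>D\<close> holds the complements of those members of \<open>L\<close>
    that lie below all upper bounds, so the limit is automatically least.\<close>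
  define U where "U = {R. projection H R \<and> (\<forall>P\<in>S. proj_le P R)}"
  define D where "D = cmpl ` {Q \<in> L. \<forall>R\<in>U. proj_le Q R}"
  have zero: "op_zero \<in> {Q \<in> L. \<forall>R\<in>U. proj_le Q R}"
    using L_zero op_0[OF projection_op] by (auto simp: U_def proj_le_iff op_zero_def)
  have D_commute: "cmpl P \<circ> cmpl Q = cmpl Q \<circ> cmpl P" if "P \<in> L" "Q \<in> L" for P Q
    using L_commute[OF that] op_diff[OF projection_op[OF L_projection[OF that(1)]]]
      op_diff[OF projection_op[OF L_projection[OF that(2)]]] by (simp add: cmpl_def fun_eq_iff)
  obtain M where M: "projection H M" "\<And>P x. P \<in> D \<Longrightarrow> P (M x) = M x"
    "\<And>F e. finite F \<Longrightarrow> e > 0 \<Longrightarrow> \<exists>P\<in>D. \<forall>x\<in>F. hnorm H (M x - P x) < e"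
    "\<And>x. (\<And>P. P \<in> D \<Longrightarrow> P x = x) \<Longrightarrow> M x = x"
  proof (rule commuting_projections_limit[of D])
    show "P \<circ> Q \<in> D" if PQ: "P \<in> D" "Q \<in> D" for P Q
    proof -
      obtain P' Q' where P': "P = cmpl P'" "P' \<in> L" "\<forall>R\<in>U. proj_le P' R"
        and Q': "Q = cmpl Q'" "Q' \<in> L" "\<forall>R\<in>U. proj_le Q' R" using PQ by (auto simp: D_def)
      have "proj_le (cmpl (P \<circ> Q)) R" if "R \<in> U" for R
      proof -
        have "R (x - y) = R x - R y" "R (x + y) = R x + R y" for x y
          using that op_diff op_plus projection_op by (auto simp: U_def)
        moreover have "cmpl (P \<circ> Q) x = P' x + Q' x - P' (Q' x)" for x
          using op_diff[OF projection_op[OF L_projection[OF P'(2)]]] by (simp add: cmpl_def P' Q')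
        moreover have "R (P' x) = P' x" "R (Q' x) = Q' x" for x
          using P'(3) Q'(3) that by (auto simp: proj_le_iff)
        ultimately show ?thesis by (simp add: proj_le_iff)
      qed
      moreover have "cmpl (P \<circ> Q) \<in> L" using L_cmpl_compose[OF P'(2) Q'(2)] P'(1) Q'(1) by simp
      ultimately show ?thesis
        unfolding D_def by (intro image_eqI[of _ _ "cmpl (P \<circ> Q)"]) auto
    qed
  qed (use zero L_projection D_commute projection_cmpl in \<open>auto simp: D_def\<close>)
  let ?N = "cmpl M"
  have N: "projection H ?N" using M(1) by (rule projection_cmpl)
  have "?N \<in> L"
  proof (rule L_closed[OF projection_op[OF N]])
    fix F :: "'h set" and e :: real assume "finite F" "e > 0"
    then obtain P where "P \<in> L" "\<forall>x\<in>F. hnorm H (M x - cmpl P x) < e"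
      using M(3)[OF \<open>finite F\<close> \<open>e > 0\<close>] by (auto simp: D_def)
    then show "\<exists>P\<in>L. \<forall>x\<in>F. hnorm H (?N x - P x) < e"
      using hnorm_minus_commute by (intro bexI[of _ P]) (auto simp: cmpl_def algebra_simps)
  qed
  have upper: "proj_le P ?N" if "P \<in> S" for P
  proof -
    have "cmpl P \<in> D" using that S by (auto simp: D_def U_def)
    then have "proj_le M (cmpl P)" using M(2) by (simp add: proj_le_iff)
    then show ?thesis
      using proj_le_cmpl[OF M(1) projection_cmpl, of P] that S L_projection by auto
  qed
  have least: "proj_le ?N R" if R: "projection H R" "\<And>P. P \<in> S \<Longrightarrow> proj_le P R" for R
  proof -
    have RU: "R \<in> U" using R by (simp add: U_def)
    have "M (cmpl R x) = cmpl R x" for x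
    proof (rule M(4))
      fix P assume "P \<in> D"
      then obtain Q where "P = cmpl Q" "Q \<in> L" "proj_le Q R" using RU by (auto simp: D_def)
      then show "P (cmpl R x) = cmpl R x"
        using proj_le_cmpl[OF L_projection R(1)] by (simp add: proj_le_iff)
    qed
    then have "proj_le (cmpl R) M" by (simp add: proj_le_iff)
    then show ?thesis using proj_le_cmpl[OF projection_cmpl[OF R(1)] M(1)] by simp
  qed
  have "proj_sup H S = ?N" using N upper least by (rule proj_sup_eqI)
  then show "proj_sup H S \<in> L" "P \<in> S \<Longrightarrow> proj_le P (proj_sup H S)"
    "projection H R \<Longrightarrow> (\<And>P. P \<in> S \<Longrightarrow> proj_le P R) \<Longrightarrow> proj_le (proj_sup H S) R"
    using \<open>?N \<in> L\<close> upper least by auto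
qed

text \<open>The projection usually written P with subscript minus.\<close>
definition predecessor :: "('h \<Rightarrow> 'h) \<Rightarrow> 'h \<Rightarrow> 'h" where
  "predecessor P = proj_sup H {Q \<in> L. \<not> proj_le P Q}"

lemma predecessor_in_L: "predecessor P \<in> L"
  unfolding predecessor_def by (rule L_sup) auto

lemma le_predecessor: "Q \<in> L \<Longrightarrow> \<not> proj_le P Q \<Longrightarrow> proj_le Q (predecessor P)"
  unfolding predecessor_def by (rule L_sup) auto

text \<open>A choice function picks from the set belonging to a nonzero M some Q not above M, so M is
  not the infimum of its values: all these infima vanish.\<close>
lemma predecessor_separating:
  assumes z: "\<And>P. P \<in> L \<Longrightarrow> P \<noteq> op_zero \<Longrightarrow> predecessor P z = z"
  shows "z = 0"
proof -
  \<comment> \<open>The suprema of these sets are exactly the predecessors of the nonzero members of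
    \<open>L\<close>.\<close>
  define \<S> where "\<S> = (\<lambda>P. {Q \<in> L. \<not> proj_le P Q}) ` (L - {op_zero})"
  have sub: "\<S> \<subseteq> Pow L" by (auto simp: \<S>_def)
  let ?G = "(\<lambda>f. proj_inf H (f ` \<S>)) ` {f. \<forall>S\<in>\<S>. f S \<in> S}"
  have G: "proj_inf H (f ` \<S>) = op_zero" if f: "\<forall>S\<in>\<S>. f S \<in> S" for f
  proof (rule ccontr)
    let ?M = "proj_inf H (f ` \<S>)"
    let ?S = "{Q \<in> L. \<not> proj_le ?M Q}"
    assume "?M \<noteq> op_zero"
    moreover have fL: "f ` \<S> \<subseteq> L" using f sub by auto
    ultimately have S: "?S \<in> \<S>" using L_inf(1)[OF fL] by (auto simp: \<S>_def)
    then have "proj_le ?M (f ?S)" using L_inf(2)[OF fL] by auto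
    then show False using f S by auto
  qed
  \<comment> \<open>The left side is the infimum of all predecessors and fixes \<open>z\<close>; the
    right side is a supremum of zeros.\<close>
  have eq: "proj_inf H (proj_sup H ` \<S>) = proj_sup H ?G"
    using L_distributive sub unfolding completely_distributive_def by blast
  have "proj_le (proj_sup H ?G) op_zero"
    by (rule L_sup) (use G L_zero L_projection in \<open>auto simp: proj_le_iff op_zero_def\<close>)
  moreover have "proj_inf H (proj_sup H ` \<S>) z = z"
  proof (rule L_inf)
    show "proj_sup H ` \<S> \<subseteq> L" using L_sup(1) sub by blast
    show "P z = z" if "P \<in> proj_sup H ` \<S>" for P
      using that z by (auto simp: \<S>_def predecessor_def)
  qed
  ultimately show ?thesis unfolding eq by (auto simp: proj_le_iff op_zero_def)
qed

end

section \<open>Rank one operators\<close>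

text \<open>Arbitrary functions fail one distributive law under composition; additive ones form a
  ring, so ring simplification becomes available. Linearity and boundedness depend on
  \<open>H\<close> and are left to the carrier set \<open>E\<close>.\<close>

typedef (overloaded) 'a endo = "{f :: 'a::ab_group_add \<Rightarrow> 'a. \<forall>x y. f (x + y) = f x + f y}"
  morphisms app Endo
  by (rule exI[of _ id]) simp

setup_lifting type_definition_endo

instantiation endo :: (ab_group_add) "{ring,monoid_mult}"
begin
lift_definition zero_endo :: "'a endo" is "\<lambda>x. 0" by simp
lift_definition one_endo :: "'a endo" is id by simp
lift_definition plus_endo :: "'a endo \<Rightarrow> 'a endo \<Rightarrow> 'a endo" is "\<lambda>f g x. f x + g x"
  by (simp add: algebra_simps)
lift_definition minus_endo :: "'a endo \<Rightarrow> 'a endo \<Rightarrow> 'a endo" is "\<lambda>f g x. f x - g x"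
  by (simp add: algebra_simps)
lift_definition uminus_endo :: "'a endo \<Rightarrow> 'a endo" is "\<lambda>f x. - f x" by simp
lift_definition times_endo :: "'a endo \<Rightarrow> 'a endo \<Rightarrow> 'a endo" is "(\<circ>)" by simp
instance
  by standard (transfer; simp add: fun_eq_iff algebra_simps)+
end

lemma app_plus [simp]: "app T (x + y) = app T x + app T y"
  using app[of T] by simp
lemma app_0 [simp]: "app T 0 = 0"
  using app_plus[of T 0 0] by simp
lemma app_minus [simp]: "app T (- x) = - app T x"
  using app_plus[of T x "- x"] by (simp add: eq_neg_iff_add_eq_0 add.commute)
lemma app_diff [simp]: "app T (x - y) = app T x - app T y"
  using app_plus[of T x "- y"] by simp
lemma app_ops [simp]: "app 0 x = 0" "app 1 x = x" "app (S + T) x = app S x + app T x"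
  "app (S - T) x = app S x - app T x" "app (- T) x = - app T x" "app (S * T) x = app S (app T x)"
  by (transfer; simp)+
lemma app_fun: "app 0 = op_zero" "app 1 = id" "app (S + T) = op_add (app S) (app T)"
  "app (S * T) = app S \<circ> app T"
  by (simp_all add: fun_eq_iff op_zero_def op_add_def)
lemma endo_eqI: "(\<And>x. app S x = app T x) \<Longrightarrow> S = T"
  by (simp add: app_inject[symmetric] ext)
lemma app_Endo: "(\<And>x y. f (x + y) = f x + f y) \<Longrightarrow> app (Endo f) = f"
  by (simp add: Endo_inverse)

section \<open>Scalars, functionals and rank one operators in the endomorphism ring\<close>

context hilbert
begin

text \<open>Scalars are embedded as ring elements, so scalar multiplication is ring
  multiplication.\<close>

definition scalar :: "complex \<Rightarrow> 'h endo" where "scalar c = Endo (sc H c)"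

lemma app_scalar [simp]: "app (scalar c) x = sc H c x"
  unfolding scalar_def by (subst app_Endo) (simp_all add: sc_add_right)

lemma app_scalar_mult: "app (scalar c * T) = op_smult H c (app T)"
  by (simp add: fun_eq_iff op_smult_def)

text \<open>Functionals replace representing vectors: \<open>f\<close> composed with an operator is
  again one, and no adjoint has to be constructed.\<close>

definition functional :: "('h \<Rightarrow> complex) \<Rightarrow> bool" where
  "functional f \<longleftrightarrow> (\<forall>x y. f (x + y) = f x + f y) \<and> (\<forall>a x. f (sc H a x) = a * f x) \<and>
     (\<exists>K. \<forall>x. cmod (f x) \<le> K * hnorm H x)"

lemma
  assumes "functional f"
  shows functional_add: "f (x + y) = f x + f y" and functional_sc: "f (sc H a x) = a * f x"
    and functional_zero: "f 0 = 0" and functional_diff: "f (x - y) = f x - f y"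
proof -
  show add: "f (x + y) = f x + f y" for x y using assms by (simp add: functional_def)
  show "f (sc H a x) = a * f x" using assms by (simp add: functional_def)
  show "f 0 = 0" using add[of 0 0] by simp
  show "f (x - y) = f x - f y" using add[of "x - y" y] by simp
qed

lemma functional_ip: "functional (\<lambda>x. ip H x u)"
proof -
  have "cmod (ip H x u) \<le> hnorm H u * hnorm H x" for x
    using cauchy_schwarz[of x u] by (simp add: mult.commute)
  then have "\<exists>K. \<forall>x. cmod (ip H x u) \<le> K * hnorm H x" by blast
  then show ?thesis by (simp add: functional_def ip_add_left ip_sc_left)
qed

lemma functional_compose:
  assumes f: "functional f" and T: "bounded_op H T" shows "functional (\<lambda>x. f (T x))"
proof -
  obtain K where K: "\<And>x. cmod (f x) \<le> K * hnorm H x" using f by (auto simp: functional_def)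
  obtain K' where K': "\<And>x. hnorm H (T x) \<le> K' * hnorm H x" using op_bound[OF T] by metis
  have "cmod (f (T x)) \<le> (max 0 K * K') * hnorm H x" for x
  proof -
    have "cmod (f (T x)) \<le> max 0 K * hnorm H (T x)"
      using K[of "T x"] by (smt (verit) hnorm_nonneg mult_right_mono)
    also have "\<dots> \<le> max 0 K * (K' * hnorm H x)" using K' by (intro mult_left_mono) auto
    finally show ?thesis by (simp add: mult.assoc)
  qed
  then have "\<exists>K. \<forall>x. cmod (f (T x)) \<le> K * hnorm H x" by blast
  then show ?thesis
    using f by (simp add: functional_def op_plus[OF T] op_sc[OF T])
qed

definition rank_one :: "'h \<Rightarrow> ('h \<Rightarrow> complex) \<Rightarrow> 'h endo" where
  "rank_one x f = Endo (\<lambda>y. sc H (f y) x)"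

lemma app_rank_one: "functional f \<Longrightarrow> app (rank_one x f) y = sc H (f y) x"
  unfolding rank_one_def by (subst app_Endo) (simp_all add: functional_add sc_add_left)

lemma bounded_op_rank_one:
  assumes f: "functional f" shows "bounded_op H (app (rank_one x f))"
proof -
  obtain K where "\<And>x. cmod (f x) \<le> K * hnorm H x" using f by (auto simp: functional_def)
  then have "cmod (f y) * hnorm H x \<le> (K * hnorm H x) * hnorm H y" for y
    using mult_right_mono[of "cmod (f y)" "K * hnorm H y" "hnorm H x"] by (simp add: algebra_simps)
  then have "hnorm H (sc H (f y) x) \<le> (K * hnorm H x) * hnorm H y" for y
    by (simp only: hnorm_sc)
  then have "\<exists>K. \<forall>y. hnorm H (sc H (f y) x) \<le> K * hnorm H y" by blast
  then show ?thesis
    unfolding bounded_op_def using f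
    by (simp add: app_rank_one functional_add functional_sc sc_add_left sc_sc)
qed

lemma sc_eq_zero: "sc H a x = 0 \<Longrightarrow> a = 0 \<or> x = 0"
  using sc_sc[of "inverse a" a x] by (cases "a = 0") auto

end

context cdcsl
begin

definition E :: "'h endo set" where "E = {T. app T \<in> Alg H L}"

lemma E_iff: "T \<in> E \<longleftrightarrow> bounded_op H (app T) \<and> (\<forall>P\<in>L. \<forall>x. P (app T (P x)) = app T (P x))"
  by (auto simp: E_def Alg_def fun_eq_iff)

lemma E_bounded: "T \<in> E \<Longrightarrow> bounded_op H (app T)"
  by (simp add: E_iff)

lemma E_invariant: "T \<in> E \<Longrightarrow> P \<in> L \<Longrightarrow> P x = x \<Longrightarrow> P (app T x) = app T x"
  unfolding E_iff by metis

lemma E_sc: "T \<in> E \<Longrightarrow> app T (sc H c x) = sc H c (app T x)"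
  by (simp add: E_bounded op_sc)

lemma L_op: "P \<in> L \<Longrightarrow> bounded_op H P"
  by (simp add: L_projection projection_op)

lemma app_L [simp]: "P \<in> L \<Longrightarrow> app (Endo P) = P"
  by (simp add: app_Endo op_plus L_op)

lemma E_one: "1 \<in> E"
  using bounded_op_id L_projection by (auto simp: E_iff app_fun(2) projection_idem)

lemma E_plus: "S \<in> E \<Longrightarrow> T \<in> E \<Longrightarrow> S + T \<in> E"
  unfolding E_iff app_fun(3) using bounded_op_add[of "app S" "app T"]
  by (auto simp: op_add_def op_plus[OF L_op])

lemma E_mult:
  assumes "S \<in> E" "T \<in> E" shows "S * T \<in> E"
  using assms bounded_op_compose[of "app S" "app T"] E_invariant
  unfolding E_iff[of "S * T"] by (auto simp: E_bounded app_fun(4) projection_idem L_projection)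

lemma E_scalar: "scalar c \<in> E"
  using bounded_op_smult[OF bounded_op_id, of c] app_scalar_mult[of c 1]
  by (auto simp: E_iff app_fun(2)) (simp add: op_smult_def op_sc[OF L_op] projection_idem[OF L_projection])

lemma E_uminus: "T \<in> E \<Longrightarrow> - T \<in> E"
proof -
  assume "T \<in> E"
  moreover have "- T = scalar (- 1) * T" by (rule endo_eqI) (simp add: sc_minus_left)
  ultimately show ?thesis by (simp add: E_scalar E_mult)
qed

lemma E_L: "P \<in> L \<Longrightarrow> Endo P \<in> E"
  using L_commute by (auto simp: E_iff L_op fun_eq_iff projection_idem[OF L_projection])

text \<open>The classical criterion for a rank one operator to leave \<open>L\<close> invariant: its
  image lies in the range of some \<open>P\<close>, and it vanishes on the range of the predecessor
  of \<open>P\<close>.\<close>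

definition supported :: "('h \<Rightarrow> 'h) \<Rightarrow> 'h \<Rightarrow> ('h \<Rightarrow> complex) \<Rightarrow> bool" where
  "supported P x f \<longleftrightarrow> P \<in> L \<and> P x = x \<and> functional f \<and> (\<forall>y. f (predecessor P y) = 0)"

text \<open>Each \<open>Q\<close> in \<open>L\<close> is either above \<open>P\<close>, and then
  fixes \<open>x\<close>, or below the predecessor of \<open>P\<close>, and then \<open>f\<close>
  vanishes on its range.\<close>

lemma rank_one_in_E:
  assumes "supported P x f" shows "rank_one x f \<in> E"
  unfolding E_iff
proof (intro conjI ballI allI)
  have P: "P \<in> L" "P x = x" "functional f" "\<And>y. f (predecessor P y) = 0"
    using assms by (auto simp: supported_def)
  show "bounded_op H (app (rank_one x f))" using P(3) by (rule bounded_op_rank_one)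
  fix Q y assume Q: "Q \<in> L"
  have "Q x = x \<or> f (Q y) = 0"
  proof (cases "proj_le P Q")
    case True
    then show ?thesis using P(2) by (metis proj_le_iff)
  next
    case False
    then show ?thesis using le_predecessor[OF Q] P(4) by (metis proj_le_iff)
  qed
  then show "Q (app (rank_one x f) (Q y)) = app (rank_one x f) (Q y)"
    using op_sc[OF L_op[OF Q]] op_0[OF L_op[OF Q]] by (auto simp: app_rank_one P(3))
qed

lemma supported_apply: "supported P x f \<Longrightarrow> T \<in> E \<Longrightarrow> supported P (app T x) f"
  by (simp add: supported_def E_invariant)

text \<open>The predecessor belongs to \<open>L\<close>, so \<open>T\<close> leaves its range
  invariant.\<close>

lemma supported_compose:
  assumes "supported P x f" "T \<in> E" shows "supported P x (\<lambda>y. f (app T y))"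
proof -
  have "app T (predecessor P y) = predecessor P (app T (predecessor P y))" for y
    using E_invariant[OF assms(2) predecessor_in_L, of P "predecessor P y"]
      projection_idem[OF L_projection[OF predecessor_in_L]] by simp
  then have "f (app T (predecessor P y)) = 0" for y
    using assms(1) unfolding supported_def by metis
  then show ?thesis
    using assms functional_compose[OF _ E_bounded] by (simp add: supported_def)
qed

lemma supported_sc:
  assumes "supported P x f" shows "supported P (sc H c x) f"
  using supported_apply[OF assms E_scalar] by simp

lemma rank_one_mult:
  assumes "functional f" "T \<in> E" shows "rank_one x f * T = rank_one x (\<lambda>y. f (app T y))"
  by (rule endo_eqI) (simp add: app_rank_one assms functional_compose E_bounded)

definition J :: "'h endo set" where "J = {rank_one x f |P x f. supported P x f}"

lemma J_subset: "J \<subseteq> E"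
  using rank_one_in_E by (auto simp: J_def)

lemma J_mult:
  assumes "r \<in> J" "t \<in> E" shows "r * t \<in> J"
proof -
  obtain P x f where r: "r = rank_one x f" "supported P x f" using assms(1) by (auto simp: J_def)
  then have "r * t = rank_one x (\<lambda>y. f (app t y))"
    using rank_one_mult assms(2) by (simp add: supported_def)
  then show ?thesis using supported_compose[OF r(2) assms(2)] by (auto simp: J_def)
qed

text \<open>If the predecessor of a nonzero \<open>P\<close> did not fix \<open>app w y\<close>, the
  remaining component \<open>?u\<close> would give a rank one operator, with image in the range of
  \<open>P\<close>, that does not kill \<open>app w y\<close>. So all these predecessors fix
  \<open>app w y\<close>, and \<open>predecessor_separating\<close> applies.\<close>

lemma J_separating:
  assumes w: "w \<in> E" "\<And>r. r \<in> J \<Longrightarrow> r * w = 0"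
  shows "w = 0"
proof (rule endo_eqI)
  fix y
  have "app w y = 0"
  proof (rule predecessor_separating)
    fix P assume P: "P \<in> L" "P \<noteq> op_zero"
    let ?N = "predecessor P" and ?z = "app w y"
    let ?u = "?z - ?N ?z"
    note N = L_projection[OF predecessor_in_L]
    obtain v where v: "P v \<noteq> 0" using P(2) by (auto simp: op_zero_def)
    have "ip H (?N x) ?u = 0" for x
      by (simp add: projection_adjoint[OF N] op_diff[OF projection_op[OF N]] projection_idem[OF N])
    then have s: "supported P (P v) (\<lambda>x. ip H x ?u)"
      using P by (simp add: supported_def functional_ip projection_idem[OF L_projection])
    then have "rank_one (P v) (\<lambda>x. ip H x ?u) * w = 0" by (intro w(2)) (auto simp: J_def)
    then have "app (rank_one (P v) (\<lambda>x. ip H x ?u) * w) y = 0" by simp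
    then have "sc H (ip H ?z ?u) (P v) = 0" by (simp add: app_rank_one functional_ip)
    then have "ip H ?z ?u = 0" using sc_eq_zero v by blast
    moreover have "ip H (?N ?z) ?u = 0" using s by (simp add: supported_def)
    ultimately have "ip H ?u ?u = 0" by (simp only: ip_diff_left diff_self)
    then show "?N ?z = ?z" using ip_definite[of ?u] by simp
  qed
  then show "app w y = app 0 y" by simp
qed

text \<open>If f vanishes on the range of P, then P + rank_one x f is an idempotent with the same range
  as P; otherwise rank_one x f is a combination of rank one operators of nonzero trace.\<close>
lemma rank_one_from_idempotents:
  assumes supp: "supported P x f"
    and diff: "\<And>r s. r \<in> G \<Longrightarrow> s \<in> G \<Longrightarrow> r - s \<in> G"
    and scale: "\<And>r c. r \<in> G \<Longrightarrow> scalar c * r \<in> G"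
    and trace_one: "\<And>P x f. supported P x f \<Longrightarrow> f x = 1 \<Longrightarrow> rank_one x f \<in> G"
    and invariant: "\<And>e. e \<in> E \<Longrightarrow> e * e = e \<Longrightarrow> (\<And>t. t \<in> E \<Longrightarrow> (1 - e) * t * e = 0) \<Longrightarrow> e \<in> G"
  shows "rank_one x f \<in> G"
proof -
  have P: "P \<in> L" "P x = x" and f: "functional f" using supp by (auto simp: supported_def)
  note P_op = L_op[OF P(1)]
  have nonzero: "rank_one z f \<in> G" if z: "supported P z f" "f z \<noteq> 0" for z
  proof -
    have "rank_one z f = scalar (f z) * rank_one (sc H (1 / f z) z) f"
      using z(2) by (intro endo_eqI) (simp add: app_rank_one f sc_sc)
    also have "\<dots> \<in> G"
      using z by (intro scale trace_one[OF supported_sc[OF z(1)]]) (simp add: functional_sc f)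
    finally show ?thesis .
  qed
  show ?thesis
  proof (cases "\<exists>z. P z = z \<and> f z \<noteq> 0")
    case True
    then obtain z where z: "P z = z" "f z \<noteq> 0" by blast
    show ?thesis
    proof (cases "f x = 0")
      case True
      \<comment> \<open>Trace zero is avoided by a shift: \<open>f\<close> takes the nonzero value
        \<open>f z\<close> at both \<open>x + z\<close> and \<open>z\<close>.\<close>
      have "rank_one x f = rank_one (x + z) f - rank_one z f"
        by (rule endo_eqI) (simp add: app_rank_one f sc_add_right)
      moreover have "supported P z f" "supported P (x + z) f"
        using supp z(1) by (auto simp: supported_def op_plus[OF L_op])
      ultimately show ?thesis
        using z(2) True by (auto intro!: diff nonzero simp: functional_add f)
    qed (use nonzero supp in blast)
  next
    case False
    then have fP: "f (P z) = 0" for z using projection_idem[OF L_projection[OF P(1)]] by blast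
    then have fx: "f x = 0" using P(2) by metis
    let ?e = "Endo P + rank_one x f"
    have e: "?e \<in> E" by (rule E_plus[OF E_L[OF P(1)] rank_one_in_E[OF supp]])
    \<comment> \<open>\<open>?e\<close> maps into the range of \<open>P\<close> and fixes it
      pointwise, which yields both idempotence and invariance under \<open>E\<close>.\<close>
    have range: "P (app ?e y) = app ?e y" for y
      using P by (simp add: app_rank_one f op_plus[OF P_op] op_sc[OF P_op]
          projection_idem[OF L_projection[OF P(1)]])
    have fixed: "app ?e y = y" if "P y = y" for y
      using that fP[of y] P(1) by (simp add: app_rank_one f)
    have "?e * ?e = ?e" by (rule endo_eqI) (simp only: app_ops(6) fixed[OF range])
    moreover have "(1 - ?e) * t * ?e = 0" if "t \<in> E" for t
    proof -
      have "?e * (t * ?e) = t * ?e"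
        by (rule endo_eqI) (simp only: app_ops(6) fixed[OF E_invariant[OF that P(1) range]])
      then show ?thesis by (simp only: left_diff_distrib mult.assoc mult_1_left diff_self)
    qed
    ultimately have "?e \<in> G" using e by (intro invariant)
    moreover have "Endo P \<in> G"
    proof (rule invariant)
      show "Endo P * Endo P = Endo P"
        using P(1) by (intro endo_eqI) (simp add: projection_idem[OF L_projection])
      show "(1 - Endo P) * t * Endo P = 0" if "t \<in> E" for t
        using P(1) E_invariant[OF that P(1)]
        by (intro endo_eqI) (simp add: projection_idem[OF L_projection])
    qed (rule E_L[OF P(1)])
    ultimately show ?thesis using diff[of ?e "Endo P"] by simp
  qed
qed

end

section \<open>Maps preserving orthogonality on CDCSL algebras\<close>

locale cdcsl_map = cdcsl H L for H :: "('h::ab_group_add) hspace" and L +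
  fixes \<phi> :: "'h endo \<Rightarrow> 'h endo"
  assumes map_scalar: "T \<in> E \<Longrightarrow> \<phi> (scalar c * T) = scalar c * \<phi> T"
    and normalized: "normalized_orthogonal_map E \<phi>"
begin

sublocale normalized_orthogonal_map E \<phi>
  by (rule normalized)

text \<open>For each off-diagonal corner element \<open>X\<close> a \<open>W\<close> in the corner
  of \<open>g\<close> is needed with \<open>X * W = X\<close> or \<open>W * X = X\<close>, such that
  \<open>W\<close> absorbs the unwanted component of \<open>\<phi> X\<close>. A rank one
  \<open>W\<close> works unless the lattice forbids it, and in that case a projection of
  \<open>L\<close> does.\<close>

lemma leibniz_rank_one_idempotent:
  assumes supp: "supported P x f" and fx: "f x = 1" and t: "t \<in> E"
  defines "e \<equiv> rank_one x f"
  shows "\<phi> (e * t) = \<phi> e * t + e * \<phi> t"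
proof -
  have P: "P \<in> L" "P x = x" and f: "functional f" using supp by (auto simp: supported_def)
  have e_app: "app e y = sc H (f y) x" for y by (simp add: e_def app_rank_one f)
  have eE: "e \<in> E" unfolding e_def by (rule rank_one_in_E[OF supp])
  have ee: "e * e = e" by (rule endo_eqI) (simp add: e_app functional_sc f fx)
  define g where "g = 1 - e"
  interpret map_at_idempotent E \<phi> e g
    by unfold_locales (simp_all add: eE ee g_def)
  have gg: "app g (app g y) = app g y" for y using ef_simps(3) app_ops(6) by metis
  show ?thesis
  proof (rule leibniz_idempotent[OF t])
    define X where "X = e * t * g"
    define q where "q = (\<lambda>y. f (app (t * g) y))"
    have XE: "X \<in> E" using t by (simp add: X_def)
    have X: "X = rank_one x q"
      unfolding X_def q_def e_def mult.assoc by (rule rank_one_mult) (use f t in auto)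
    have qs: "supported P x q" unfolding q_def by (rule supported_compose[OF supp]) (use t in simp)
    then have qf: "functional q" by (simp add: supported_def)
    have X_app: "app X y = sc H (q y) x" for y by (simp add: X app_rank_one qf)
    have qg: "q (app g y) = q y" for y by (simp add: q_def gg)
    have Xg: "X * g = X" "X = e * X * g" by (simp_all add: X_def mult.assoc)
    define v where "v = app (\<phi> X) x"
    have "app (X * \<phi> X * e) x = 0" using annihilate_ef[OF t] by (simp add: X_def)
    then have "sc H (q v) x = 0" by (simp add: e_app fx X_app v_def)
    then have "f (sc H (q v) x) = 0" by (simp add: functional_zero f)
    then have qv: "q v = 0" by (simp add: functional_sc f fx)
    have transfer: "app g v = app W v" if W: "W \<in> E" "W = g * W * g" "X * W = X" for W
    proof -
      have "g * \<phi> (X * W) * e = W * \<phi> X * e" by (rule transfer_ef[OF XE Xg(2) W(1,2)])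
      then have "app (g * \<phi> X * e) x = app (W * \<phi> X * e) x" by (simp only: W(3))
      then show ?thesis by (simp add: e_app fx v_def)
    qed
    have "app g v = 0"
    proof (cases "\<exists>w. P w = w \<and> q w \<noteq> 0")
      case True
      then obtain w0 where w0: "P w0 = w0" "q w0 \<noteq> 0" by blast
      define w where "w = sc H (1 / q w0) w0"
      have w: "P w = w" "q w = 1" using w0 P(1) by (simp_all add: w_def op_sc[OF L_op] functional_sc qf)
      then have ws: "supported P w q" using qs by (simp add: supported_def)
      let ?W = "g * rank_one w q * g"
      have W_app: "app ?W y = app g (sc H (q y) w)" for y by (simp add: app_rank_one qf qg)
      have "?W \<in> E" using rank_one_in_E[OF ws] by simp
      moreover have "X * ?W = X"
        by (rule endo_eqI) (simp only: app_ops(6)[of X] W_app X_app qg functional_sc[OF qf] w mult_1_right)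
      ultimately have "app g v = app ?W v" by (intro transfer) (simp_all add: mult.assoc)
      then show ?thesis by (simp only: W_app qv sc_zero_left app_0)
    next
      case False
      then have qP: "q (P y) = 0" for y using projection_idem[OF L_projection[OF P(1)]] by blast
      \<comment> \<open>Now \<open>q\<close> vanishes on the range of \<open>P\<close>, so
        \<open>1 - P\<close> does not change \<open>q\<close>, while \<open>app g v\<close> lies in
        that range and is killed.\<close>
      let ?W = "g * (1 - Endo P) * g"
      have W_app: "app ?W y = app g (app g y - P (app g y))" for y using P(1) by simp
      have "?W \<in> E" using E_L[OF P(1)] by simp
      moreover have "X * ?W = X"
        by (rule endo_eqI) (simp only: app_ops(6)[of X] W_app X_app qg functional_diff[OF qf] qP diff_zero)
      ultimately have "app g v = app ?W v" by (intro transfer) (simp_all add: mult.assoc)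
      moreover have "P (app g v) = app g v"
        unfolding v_def by (intro E_invariant[OF _ P(1)] P(2)) (use XE in simp_all)
      ultimately show ?thesis by (simp only: W_app diff_self app_0)
    qed
    then show "g * \<phi> (e * t * g) * e = 0"
      using XE by (intro endo_eqI) (simp add: e_app E_sc v_def flip: X_def)
  next
    define X where "X = g * t * e"
    define y where "y = app (g * t) x"
    have XE: "X \<in> E" using t by (simp add: X_def)
    have X_app: "app X z = sc H (f z) y" for z
      using t by (simp add: X_def y_def e_app E_sc)
    have gy: "app g y = y" by (simp add: y_def gg)
    have Xe: "X = g * X * e" by (simp add: X_def mult.assoc)
    have Py: "P y = y" unfolding y_def by (intro E_invariant[OF _ P(1)] P(2)) (use t in simp)
    have "app (e * \<phi> X * X) x = 0" using annihilate_fe[OF t] by (simp add: X_def)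
    then have ey: "app e (app (\<phi> X) y) = 0" by (simp add: X_app fx)
    have transfer: "app e (app (\<phi> X) (app g z)) = app e (app (\<phi> X) (app W z))"
      if W: "W \<in> E" "W = g * W * g" "W * X = X" for W z
    proof -
      have "e * \<phi> (W * X) * g = e * \<phi> X * W" by (rule transfer_fe[OF XE Xe W(1,2)])
      then have "app (e * \<phi> X * g) z = app (e * \<phi> X * W) z" by (simp only: W(3))
      then show ?thesis by simp
    qed
    let ?N = "predecessor P"
    note N = L_projection[OF predecessor_in_L[of P]]
    note N_op = projection_op[OF N]
    have "app e (app (\<phi> X) (app g z)) = 0" for z
    proof (cases "?N y = y")
      case False
      \<comment> \<open>Normalized so that the rank one operator fixes \<open>y\<close> and has
        image in its span; on that span \<open>ey\<close> gives zero.\<close>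
      define u where "u = y - ?N y"
      define w where "w = sc H (1 / ip H y u) y"
      have qs: "supported P w (\<lambda>z. ip H z u)"
        using P(1) Py by (simp add: supported_def functional_ip projection_adjoint[OF N] u_def
            op_diff[OF N_op] projection_idem[OF N] w_def op_sc[OF L_op])
      have "ip H y u \<noteq> 0"
      proof
        assume "ip H y u = 0"
        moreover have "ip H (?N y) u = 0" using qs by (simp add: supported_def)
        ultimately have "ip H u u = 0" by (simp add: u_def ip_diff_left)
        then show False using False ip_definite[of u] by (simp add: u_def)
      qed
      then have qy: "sc H (ip H (sc H c y) u) w = sc H c y" for c
        by (simp add: w_def sc_sc ip_sc_left)
      let ?W = "g * rank_one w (\<lambda>z. ip H z u) * g"
      have W_app: "app ?W z = app g (sc H (ip H (app g z) u) w)" for z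
        by (simp add: app_rank_one functional_ip)
      have WE: "?W \<in> E" using rank_one_in_E[OF qs] by simp
      have gsc: "app g (sc H c y) = sc H c y" for c using E_sc[OF f_in] gy by simp
      have "?W * X = X"
        by (rule endo_eqI) (simp only: app_ops(6)[of _ X] W_app X_app gsc qy)
      then have "app e (app (\<phi> X) (app g z)) = app e (app (\<phi> X) (app ?W z))"
        using WE by (intro transfer) (simp_all add: mult.assoc)
      also have "app ?W z = sc H (ip H (app g z) u * (1 / ip H y u)) y"
        unfolding W_app by (simp only: w_def sc_sc gsc)
      finally show ?thesis using XE by (simp only: E_sc[OF eE] E_sc[OF map_closed[OF XE]] ey sc_zero_right)
    next
      case True
      \<comment> \<open>Here \<open>y\<close> is in the range of the predecessor, so
        \<open>?N\<close> fixes it, while \<open>f\<close> after an element of \<open>E\<close>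
        vanishes on that range.\<close>
      let ?W = "g * Endo ?N * g"
      have W_app: "app ?W z = app g (?N (app g z))" for z using predecessor_in_L by simp
      have WE: "?W \<in> E" using E_L[OF predecessor_in_L] by simp
      have gsc: "app g (sc H c y) = sc H c y" for c using E_sc[OF f_in] gy by simp
      have "?W * X = X"
        by (rule endo_eqI) (simp only: app_ops(6)[of _ X] W_app X_app gsc op_sc[OF N_op] True)
      then have "app e (app (\<phi> X) (app g z)) = app e (app (\<phi> X) (app ?W z))"
        using WE by (intro transfer) (simp_all add: mult.assoc)
      moreover have "supported P x (\<lambda>z. f (app (\<phi> X * g) z))"
        by (rule supported_compose[OF supp]) (use XE in simp)
      then have "f (app (\<phi> X) (app ?W z)) = 0"
        unfolding W_app supported_def by simp
      ultimately show ?thesis by (simp only: e_app sc_zero_left)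
    qed
    then show "e * \<phi> (g * t * e) * g = 0"
      by (intro endo_eqI) (simp flip: X_def)
  qed
qed

text \<open>One off-diagonal corner of the algebra is zero, so nothing can be mapped into it or out
  of it.\<close>

lemma leibniz_invariant_idempotent:
  assumes e: "e \<in> E" "e * e = e" and inv: "\<And>t. t \<in> E \<Longrightarrow> (1 - e) * t * e = 0" and t: "t \<in> E"
  shows "\<phi> (e * t) = \<phi> e * t + e * \<phi> t"
proof -
  interpret map_at_idempotent E \<phi> e "1 - e"
    by unfold_locales (simp_all add: e)
  show ?thesis
    by (rule leibniz_idempotent) (use t inv in simp_all)
qed

lemma leibniz_rank_one:
  assumes r: "r \<in> J" and t: "t \<in> E"
  shows "\<phi> (r * t) = \<phi> r * t + r * \<phi> t"
proof -
  \<comment> \<open>The admissible left factors are closed under differences and scalars, hence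
    \<open>rank_one_from_idempotents\<close> reaches trace zero as well.\<close>
  define G where "G = {r \<in> E. \<forall>t\<in>E. \<phi> (r * t) = \<phi> r * t + r * \<phi> t}"
  obtain P x f where r_eq: "r = rank_one x f" and s: "supported P x f" using r by (auto simp: J_def)
  have "rank_one x f \<in> G"
  proof (rule rank_one_from_idempotents[OF s])
    show "r - s \<in> G" if "r \<in> G" "s \<in> G" for r s
      using that by (auto simp: G_def map_diff algebra_simps)
    show "scalar c * r \<in> G" if "r \<in> G" for r c
      using that by (auto simp: G_def map_scalar E_scalar mult.assoc distrib_left)
    show "rank_one x f \<in> G" if "supported P x f" "f x = 1" for P x f
      using leibniz_rank_one_idempotent[OF that] rank_one_in_E[OF that(1)] by (simp add: G_def)
    show "e \<in> G" if "e \<in> E" "e * e = e" "\<And>t. t \<in> E \<Longrightarrow> (1 - e) * t * e = 0" for e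
      using leibniz_invariant_idempotent[OF that] that(1) by (simp add: G_def)
  qed
  then show ?thesis using t by (simp add: G_def r_eq)
qed

lemma leibniz: "s \<in> E \<Longrightarrow> t \<in> E \<Longrightarrow> \<phi> (s * t) = \<phi> s * t + s * \<phi> t"
  using J_subset J_mult leibniz_rank_one J_separating by (rule leibniz_if_separating)

end

section \<open>Centrality of \<open>\<phi> 1\<close> and transfer between endomorphisms and
  functions\<close>

context cdcsl
begin

lemma scalar_commute: "T \<in> E \<Longrightarrow> scalar c * T = T * scalar c"
  by (rule endo_eqI) (simp add: E_sc)

text \<open>The commutant of \<open>\<phi> 1\<close> contains all idempotents of \<open>E\<close>
  and is closed under differences and scalars, so it contains \<open>J\<close>; separation then
  extends this to \<open>E\<close>.\<close>

lemma map_one_central: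
  assumes "orthogonal_map E \<phi>" "t \<in> E"
  shows "\<phi> 1 * t = t * \<phi> 1"
proof -
  interpret orthogonal_map E \<phi> by fact
  have "\<phi> 1 * r = r * \<phi> 1" if "r \<in> J" for r
  proof -
    define G where "G = {r. \<phi> 1 * r = r * \<phi> 1}"
    obtain P x f where r_eq: "r = rank_one x f" and s: "supported P x f" using \<open>r \<in> J\<close> by (auto simp: J_def)
    have "rank_one x f \<in> G"
    proof (rule rank_one_from_idempotents[OF s])
      show "r - s \<in> G" if "r \<in> G" "s \<in> G" for r s
        using that by (simp add: G_def algebra_simps)
      show "scalar c * r \<in> G" if "r \<in> G" for r c
        using that scalar_commute[OF map_closed[OF A_one], of c] unfolding G_def
        by (metis (mono_tags, lifting) mem_Collect_eq mult.assoc)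
      show "rank_one x f \<in> G" if "supported P x f" "f x = 1" for P x f
      proof -
        have f: "functional f" using that by (simp add: supported_def)
        have "rank_one x f * rank_one x f = rank_one x f"
          by (rule endo_eqI) (simp add: app_rank_one f functional_sc that(2))
        then show ?thesis
          using map_one_commute_idempotent[OF rank_one_in_E[OF that(1)]] by (simp add: G_def)
      qed
    qed (auto simp: G_def map_one_commute_idempotent)
    then show ?thesis by (simp add: G_def r_eq)
  qed
  then show ?thesis
    using map_one_central_if_separating[of J t] J_mult J_separating assms(2) by blast
qed

lemma Alg_Endo:
  assumes "X \<in> Alg H L" shows "app (Endo X) = X" "Endo X \<in> E"
proof -
  show "app (Endo X) = X" using assms by (intro app_Endo) (simp add: Alg_def op_plus)
  then show "Endo X \<in> E" using assms by (simp add: E_def)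
qed

lemma Endo_ops:
  assumes "X \<in> Alg H L" "Y \<in> Alg H L"
  shows "Endo (op_add X Y) = Endo X + Endo Y" "Endo (X \<circ> Y) = Endo X * Endo Y"
proof -
  note XY = Alg_Endo(1)[OF assms(1)] Alg_Endo(1)[OF assms(2)]
  show "Endo (op_add X Y) = Endo X + Endo Y"
    using app_inverse[of "Endo X + Endo Y"] by (simp only: app_fun XY)
  show "Endo (X \<circ> Y) = Endo X * Endo Y"
    using app_inverse[of "Endo X * Endo Y"] by (simp only: app_fun XY)
qed

lemma Endo_smult: "X \<in> Alg H L \<Longrightarrow> Endo (op_smult H c X) = scalar c * Endo X"
  using app_inverse[of "scalar c * Endo X"] by (simp only: app_scalar_mult Alg_Endo(1))

lemma Alg_ops:
  assumes "X \<in> Alg H L" "Y \<in> Alg H L"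
  shows "op_add X Y \<in> Alg H L" "X \<circ> Y \<in> Alg H L"
proof -
  note XY = Alg_Endo[OF assms(1)] Alg_Endo[OF assms(2)]
  show "op_add X Y \<in> Alg H L" using E_plus[OF XY(2,4)] by (simp add: E_def app_fun XY)
  show "X \<circ> Y \<in> Alg H L" using E_mult[OF XY(2,4)] by (simp add: E_def app_fun XY)
qed

lemma Alg_smult: "X \<in> Alg H L \<Longrightarrow> op_smult H c X \<in> Alg H L"
  using E_mult[OF E_scalar[of c] Alg_Endo(2)] by (simp add: E_def app_scalar_mult Alg_Endo(1))

lemma linear_on_Alg:
  assumes closed: "\<And>T. T \<in> E \<Longrightarrow> D T \<in> E"
    and add: "\<And>S T. S \<in> E \<Longrightarrow> T \<in> E \<Longrightarrow> D (S + T) = D S + D T"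
    and scale: "\<And>c T. T \<in> E \<Longrightarrow> D (scalar c * T) = scalar c * D T"
    and \<delta>: "\<And>X. X \<in> Alg H L \<Longrightarrow> \<delta> X = app (D (Endo X))"
  shows "linear_on H (Alg H L) \<delta>"
  unfolding linear_on_def
  by (auto simp: \<delta> Alg_ops Alg_smult Endo_ops Endo_smult add scale Alg_Endo(2) app_fun(3) app_scalar_mult)
    (use closed Alg_Endo(2) in \<open>auto simp: E_def\<close>)

end

theorem theorem2p14:
  fixes H :: "('h::ab_group_add) hspace"
    and L :: "('h \<Rightarrow> 'h) set"
    and \<phi> :: "('h \<Rightarrow> 'h) \<Rightarrow> ('h \<Rightarrow> 'h)"
  assumes "complex_hilbert_space H"
    and "separable H"
    and "CDCSL H L"
    and "linear_on H (Alg H L) \<phi>"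
    and "\<forall>A\<in>Alg H L. \<forall>B\<in>Alg H L. A \<circ> B = op_zero \<and> B \<circ> A = op_zero \<longrightarrow>
           op_add (jordan (\<phi> A) B) (jordan A (\<phi> B)) = op_zero"
  shows "(\<exists>\<delta> \<eta>. derivation_on H (Alg H L) \<delta> \<and> multiplier_on H (Alg H L) \<eta> \<and>
            (\<forall>X\<in>Alg H L. \<phi> X = op_add (\<delta> X) (\<eta> X)))
         \<and> (\<phi> id = op_zero \<longrightarrow> derivation_on H (Alg H L) \<phi>)"
proof -
  interpret cdcsl H L
    using assms(1,3) by unfold_locales
  define \<Phi> where "\<Phi> T = Endo (\<phi> (app T))" for T
  have \<phi>_lin: "\<phi> X \<in> Alg H L" "Y \<in> Alg H L \<Longrightarrow> \<phi> (op_add X Y) = op_add (\<phi> X) (\<phi> Y)"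
    "\<phi> (op_smult H c X) = op_smult H c (\<phi> X)" if "X \<in> Alg H L" for X Y c
    using assms(4) that by (auto simp: linear_on_def)
  have E_Alg: "app T \<in> Alg H L" if "T \<in> E" for T using that by (simp add: E_def)
  have app_\<Phi>: "app (\<Phi> T) = \<phi> (app T)" "\<Phi> T \<in> E" if "T \<in> E" for T
    using Alg_Endo[OF \<phi>_lin(1)] E_Alg[OF that] by (auto simp: \<Phi>_def)
  have \<Phi>_add: "\<Phi> (S + T) = \<Phi> S + \<Phi> T" if "S \<in> E" "T \<in> E" for S T
    using that by (simp add: \<Phi>_def app_fun \<phi>_lin E_Alg Endo_ops)
  have \<Phi>_scalar: "\<Phi> (scalar c * T) = scalar c * \<Phi> T" if "T \<in> E" for c T
    using that by (simp add: \<Phi>_def app_scalar_mult \<phi>_lin E_Alg Endo_smult)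
  interpret \<Phi>: orthogonal_map E \<Phi>
  proof unfold_locales
    fix S T assume ST: "S \<in> E" "T \<in> E" "S * T = 0" "T * S = 0"
    then have "app S \<circ> app T = op_zero" "app T \<circ> app S = op_zero"
      by (simp_all flip: app_fun)
    then have "op_add (jordan (\<phi> (app S)) (app T)) (jordan (app S) (\<phi> (app T))) = op_zero"
      using assms(5) E_Alg ST(1,2) by blast
    then have eq: "op_add (jordan (app (\<Phi> S)) (app T)) (jordan (app S) (app (\<Phi> T))) z = 0" for z
      using ST by (simp add: app_\<Phi> op_zero_def)
    show "\<Phi> S * T + T * \<Phi> S + S * \<Phi> T + \<Phi> T * S = 0"
      by (rule endo_eqI) (use eq in \<open>simp add: jordan_def op_add_def add.assoc\<close>)
  next
    fix S :: "'h endo" assume S: "S + S = 0"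
    show "S = 0"
    proof (rule endo_eqI)
      fix x
      \<comment> \<open>Division by 2 comes from the complex scalars.\<close>
      have "app S x = sc H (1 / 2 + 1 / 2) (app S x)" by simp
      also have "\<dots> = sc H (1 / 2) (app (S + S) x)"
        by (simp only: sc_add_left sc_add_right app_ops)
      finally show "app S x = app 0 x" by (simp add: S)
    qed
  qed (simp_all add: E_one E_plus E_uminus E_mult app_\<Phi> \<Phi>_add)
  define c where "c = \<Phi> 1"
  have c: "c \<in> E" "\<And>T. T \<in> E \<Longrightarrow> c * T = T * c"
    using map_one_central[OF \<Phi>.orthogonal_map_axioms] by (simp_all add: c_def)
  define \<Psi> where "\<Psi> T = \<Phi> T - c * T" for T
  interpret \<Psi>: cdcsl_map H L \<Psi>
  proof (intro cdcsl_map.intro cdcsl_axioms cdcsl_map_axioms.intro)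
    show "\<Psi> (scalar a * T) = scalar a * \<Psi> T" if "T \<in> E" for a T
      using that scalar_commute[OF c(1), of a]
      by (simp add: \<Psi>_def \<Phi>_scalar right_diff_distrib flip: mult.assoc)
    show "normalized_orthogonal_map E \<Psi>"
      using \<Phi>.normalized_orthogonal_map c(2) unfolding \<Psi>_def c_def by blast
  qed
  define \<delta> where "\<delta> X = app (\<Psi> (Endo X))" for X
  define \<eta> where "\<eta> X = app (c * Endo X)" for X
  \<comment> \<open>Stated for any map agreeing with \<open>\<Psi>\<close> on the algebra, so that
    it serves \<open>\<delta>\<close> and, when \<open>\<phi> id\<close> is zero,
    \<open>\<phi>\<close> itself, whose values outside the algebra are arbitrary.\<close>
  have derivation: "derivation_on H (Alg H L) \<epsilon>"
    if "\<And>X. X \<in> Alg H L \<Longrightarrow> \<epsilon> X = app (\<Psi> (Endo X))" for \<epsilon>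
    unfolding derivation_on_def
  proof (intro conjI ballI)
    show "linear_on H (Alg H L) \<epsilon>"
      by (rule linear_on_Alg[OF \<Psi>.map_closed \<Psi>.map_add \<Psi>.map_scalar that])
    show "\<epsilon> (X \<circ> Y) = op_add (\<epsilon> X \<circ> Y) (X \<circ> \<epsilon> Y)" if "X \<in> Alg H L" "Y \<in> Alg H L" for X Y
      using that \<open>\<And>X. X \<in> Alg H L \<Longrightarrow> \<epsilon> X = app (\<Psi> (Endo X))\<close>
      by (simp add: Alg_ops Endo_ops Alg_Endo \<Psi>.leibniz app_fun)
  qed
  have Endo_id: "Endo id = 1" using app_inverse[of 1] by (simp add: app_fun)
  have "multiplier_on H (Alg H L) \<eta>"
    unfolding multiplier_on_def
  proof (intro conjI ballI)
    show "linear_on H (Alg H L) \<eta>"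
    proof (rule linear_on_Alg[where D = "\<lambda>T. c * T"])
      show "c * (scalar a * T) = scalar a * (c * T)" for a T
        using scalar_commute[OF c(1), of a] by (simp flip: mult.assoc)
    qed (simp_all add: \<eta>_def c(1) E_mult distrib_left)
    show "\<eta> X = \<eta> id \<circ> X" if "X \<in> Alg H L" for X
      using that by (simp add: \<eta>_def Endo_id app_fun Alg_Endo)
    show "\<eta> X = X \<circ> \<eta> id" if "X \<in> Alg H L" for X
      using that by (simp add: \<eta>_def Endo_id c(2) app_fun Alg_Endo)
  qed
  moreover have "\<phi> X = op_add (\<delta> X) (\<eta> X)" if "X \<in> Alg H L" for X
    using app_\<Phi>(1)[OF Alg_Endo(2)[OF that]] that
    by (simp add: \<delta>_def \<eta>_def \<Psi>_def Alg_Endo flip: app_fun)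
  moreover have "derivation_on H (Alg H L) \<delta>" by (rule derivation) (simp add: \<delta>_def)
  moreover have "derivation_on H (Alg H L) \<phi>" if "\<phi> id = op_zero"
  proof (rule derivation)
    have "c = 0" using that app_inverse[of "0 :: 'h endo"] by (simp add: c_def \<Phi>_def app_fun)
    then show "\<phi> X = app (\<Psi> (Endo X))" if "X \<in> Alg H L" for X
      using app_\<Phi>(1)[OF Alg_Endo(2)[OF that]] that by (simp add: \<Psi>_def Alg_Endo)
  qed
  ultimately show ?thesis by blast
qed

end
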